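(* Let $P=\{1_P,\dots,L_P\}$ be a chain of $L$ qubits and let $C$ be a (nonzero) Clifford monitored dynamics on $P$, i.e. a product $C=C_tC_{t-1}\cdots C_1$ in which every factor is either a two-qubit Clifford unitary or a single-qubit projector $\frac{1\pm Z_i}{2}$ onto a fixed outcome of a Pauli-$Z$ measurement. Define the input and output code projectors $P_{\mathrm{in}}=C^\dagger C$ and $P_{\mathrm{out}}=CC^\dagger$. Let $R=\{1_R,\dots,L_R\}$ be a reference copy of $P$ and let $$|\phi\rangle\propto\sum_{\mathbf{s}\in\{0,1\}^L}\big(C|\mathbf{s}\rangle\big)_P\otimes|\mathbf{s}\rangle_R$$ (normalized). For subsets $A,B\subseteq\{1,\dots,L\}$ of sites, write $A_R\subseteq R$ and $B_P\subseteq P$ for the corresponding qubits, and let $I_{A_R:B_P}=S_{A_R}+S_{B_P}-S_{A_R\cup B_P}$ be the mutual information of $|\phi\rangle$ (von Neumann entropies in base $2$). Then $I_{A_R:B_P}$ equals the number of independent and inequivalent Pauli logical operators of the input code that are supported on $A$ and can be transferred by $C$ to some logical operator of the output code supported on $B$.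
   Context: All nonzero singular values of such a $C$ equal $1$, so $P_{\mathrm{in}}$ and $P_{\mathrm{out}}$ are projectors onto stabilizer code subspaces $\mathcal{H}_{\mathrm{in}}$ and $\mathcal{H}_{\mathrm{out}}$. A Pauli operator is a tensor product of single-qubit operators $I,X,Y,Z$ (up to a phase). A (Pauli) logical operator of a code with projector $\Pi$ is a Pauli operator $O$ that commutes with $\Pi$; two logical operators $O,O'$ are equivalent if they act identically on the code space ($O\Pi=O'\Pi$), and a logical operator is trivial if it acts on the code space as a multiple of the identity. A logical operator $O$ of the input code is transferred by $C$ to a logical operator $\tilde O$ of the output code if $CO=\tilde{O}C$. "Supported on $A$" means acting as the identity outside $A$. "Independent and inequivalent" means the operators are counted as independent generators modulo equivalence: no nontrivial product of them is a trivial logical operator. *)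

theory Defs
  imports "Jordan_Normal_Form.Char_Poly" "HOL-Computational_Algebra.Polynomial"
begin

section \<open>Qubit registers: n qubits, basis index i < 2^n, bit j of i is the state of qubit j\<close>

definition qbit :: "nat \<Rightarrow> nat \<Rightarrow> nat" where
  "qbit j i = (i div 2 ^ j) mod 2"

definition dagger :: "complex mat \<Rightarrow> complex mat" where
  "dagger A = mat (dim_col A) (dim_row A) (\<lambda>(i, j). cnj (A $$ (j, i)))"

text \<open>Single-qubit Paulis: 0 = I, 1 = X, 2 = Y, 3 = Z; entry (a,b) in the computational basis.\<close>
definition pauli1 :: "nat \<Rightarrow> nat \<Rightarrow> nat \<Rightarrow> complex" where
  "pauli1 k a b =
     (if k = 0 then (if a = b then 1 else 0)
      else if k = 1 then (if a \<noteq> b then 1 else 0)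
      else if k = 2 then (if a = 0 \<and> b = 1 then - \<i> else if a = 1 \<and> b = 0 then \<i> else 0)
      else (if a = b then (if a = 0 then 1 else -1) else 0))"

definition pauli_string :: "nat \<Rightarrow> (nat \<Rightarrow> nat) \<Rightarrow> bool" where
  "pauli_string n p \<longleftrightarrow> (\<forall>j<n. p j < 4) \<and> (\<forall>j\<ge>n. p j = 0)"

definition pauli_mat :: "nat \<Rightarrow> (nat \<Rightarrow> nat) \<Rightarrow> complex mat" where
  "pauli_mat n p = mat (2 ^ n) (2 ^ n) (\<lambda>(r, c). \<Prod>j<n. pauli1 (p j) (qbit j r) (qbit j c))"

definition phases :: "complex set" where
  "phases = {1, -1, \<i>, - \<i>}"

definition is_pauli_op :: "nat \<Rightarrow> complex mat \<Rightarrow> bool" where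
  "is_pauli_op n Op \<longleftrightarrow> (\<exists>c p. c \<in> phases \<and> pauli_string n p \<and> Op = c \<cdot>\<^sub>m pauli_mat n p)"

definition supported_on :: "(nat \<Rightarrow> nat) \<Rightarrow> nat set \<Rightarrow> bool" where
  "supported_on p A \<longleftrightarrow> (\<forall>j. j \<notin> A \<longrightarrow> p j = 0)"

definition pauli_op_supported_on :: "nat \<Rightarrow> complex mat \<Rightarrow> nat set \<Rightarrow> bool" where
  "pauli_op_supported_on n Op A \<longleftrightarrow>
     (\<exists>c p. c \<in> phases \<and> pauli_string n p \<and> supported_on p A \<and> Op = c \<cdot>\<^sub>m pauli_mat n p)"

definition unitary_mat :: "nat \<Rightarrow> complex mat \<Rightarrow> bool" where
  "unitary_mat d U \<longleftrightarrow> U \<in> carrier_mat d d \<and> U * dagger U = 1\<^sub>m d \<and> dagger U * U = 1\<^sub>m d"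

text \<open>Two-qubit Clifford unitary: a 4x4 unitary mapping Pauli operators to Pauli operators by conjugation.
  Basis index of the 4x4 matrix: bit 0 = first qubit, bit 1 = second qubit.\<close>
definition clifford2 :: "complex mat \<Rightarrow> bool" where
  "clifford2 U \<longleftrightarrow> unitary_mat 4 U \<and>
     (\<forall>p. pauli_string 2 p \<longrightarrow> is_pauli_op 2 (U * pauli_mat 2 p * dagger U))"

datatype gate =
    Gate2 nat nat "complex mat"
  | ZProj nat bool              \<comment> \<open>ZProj i True = (1 + Z_i)/2, ZProj i False = (1 - Z_i)/2\<close>

definition valid_gate :: "nat \<Rightarrow> gate \<Rightarrow> bool" where
  "valid_gate L g = (case g of
      Gate2 a b U \<Rightarrow> a < L \<and> b < L \<and> a \<noteq> b \<and> clifford2 U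
    | ZProj i s \<Rightarrow> i < L)"

definition gate_mat :: "nat \<Rightarrow> gate \<Rightarrow> complex mat" where
  "gate_mat L g = (case g of
      Gate2 a b U \<Rightarrow> mat (2 ^ L) (2 ^ L) (\<lambda>(r, c).
         if (\<forall>j<L. j \<noteq> a \<longrightarrow> j \<noteq> b \<longrightarrow> qbit j r = qbit j c)
         then U $$ (qbit a r + 2 * qbit b r, qbit a c + 2 * qbit b c) else 0)
    | ZProj i s \<Rightarrow> mat (2 ^ L) (2 ^ L) (\<lambda>(r, c).
         if r = c \<and> (qbit i r = 0 \<longleftrightarrow> s) then 1 else 0))"

definition circuit_mat :: "nat \<Rightarrow> gate list \<Rightarrow> complex mat" where
  "circuit_mat L gs = fold (\<lambda>g M. gate_mat L g * M) gs (1\<^sub>m (2 ^ L))"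

definition logical_op :: "complex mat \<Rightarrow> complex mat \<Rightarrow> bool" where
  "logical_op Pr Op \<longleftrightarrow> Op * Pr = Pr * Op"

definition trivial_on_code :: "complex mat \<Rightarrow> complex mat \<Rightarrow> bool" where
  "trivial_on_code Pr Op \<longleftrightarrow> (\<exists>c. Op * Pr = c \<cdot>\<^sub>m Pr)"

definition transferable :: "nat \<Rightarrow> complex mat \<Rightarrow> nat set \<Rightarrow> nat set \<Rightarrow> (nat \<Rightarrow> nat) \<Rightarrow> bool" where
  "transferable L C A B p \<longleftrightarrow>
     pauli_string L p \<and> supported_on p A \<and> logical_op (dagger C * C) (pauli_mat L p) \<and>
     (\<exists>Ot. pauli_op_supported_on L Ot B \<and> logical_op (C * dagger C) Ot \<and>
           C * pauli_mat L p = Ot * C)"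

text \<open>Independent and inequivalent: no nontrivial product is a trivial logical operator.\<close>
definition independent_logicals :: "nat \<Rightarrow> complex mat \<Rightarrow> (nat \<Rightarrow> nat) set \<Rightarrow> bool" where
  "independent_logicals n Pr S \<longleftrightarrow>
     (\<forall>xs. distinct xs \<longrightarrow> set xs \<subseteq> S \<longrightarrow> xs \<noteq> [] \<longrightarrow>
        \<not> trivial_on_code Pr (foldr (\<lambda>p M. pauli_mat n p * M) xs (1\<^sub>m (2 ^ n))))"

definition num_transferable :: "nat \<Rightarrow> complex mat \<Rightarrow> nat set \<Rightarrow> nat set \<Rightarrow> nat" where
  "num_transferable L C A B =
     Max {card S | S. S \<subseteq> {p. transferable L C A B p} \<and> independent_logicals L (dagger C * C) S}"

text \<open>State on 2L qubits: qubit j < L is site j of P, qubit L + j is site j of R.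
  Amplitude at index i is C_{(i mod 2^L), (i div 2^L)}, normalized.\<close>
definition choi_state :: "nat \<Rightarrow> complex mat \<Rightarrow> nat \<Rightarrow> complex" where
  "choi_state L C i =
     C $$ (i mod 2 ^ L, i div 2 ^ L) /
     complex_of_real (sqrt (\<Sum>r<2 ^ L. \<Sum>s<2 ^ L. (cmod (C $$ (r, s)))\<^sup>2))"

definition place_bits :: "nat list \<Rightarrow> nat \<Rightarrow> nat" where
  "place_bits xs k = (\<Sum>m<length xs. qbit m k * 2 ^ (xs ! m))"

definition reduced_dm :: "nat \<Rightarrow> (nat \<Rightarrow> complex) \<Rightarrow> nat set \<Rightarrow> complex mat" where
  "reduced_dm N psi X =
     (let xs = sorted_list_of_set X; ys = sorted_list_of_set ({0..<N} - X) in
      mat (2 ^ length xs) (2 ^ length xs) (\<lambda>(k, k').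
        \<Sum>e<2 ^ length ys. psi (place_bits xs k + place_bits ys e) *
                            cnj (psi (place_bits xs k' + place_bits ys e))))"

definition ent_fun :: "real \<Rightarrow> real" where
  "ent_fun x = (if x \<le> 0 then 0 else - x * log 2 x)"

definition vn_entropy :: "complex mat \<Rightarrow> real" where
  "vn_entropy \<rho> =
     (\<Sum>a\<in>{a. poly (char_poly \<rho>) a = 0}. real (order a (char_poly \<rho>)) * ent_fun (Re a))"

definition mutual_info :: "nat \<Rightarrow> (nat \<Rightarrow> complex) \<Rightarrow> nat set \<Rightarrow> nat set \<Rightarrow> real" where
  "mutual_info N psi X Y =
     vn_entropy (reduced_dm N psi X) + vn_entropy (reduced_dm N psi Y)
     - vn_entropy (reduced_dm N psi (X \<union> Y))"

end

theory Submission
  imports Defs "Jordan_Normal_Form.Schur_Decomposition"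
begin

text \<open>
  Call a matrix \<open>C\<close> dichotomic if for all Pauli strings \<open>P\<close>, \<open>Q\<close> either \<open>P C Q\<close> is a multiple of \<open>C\<close>
  or \<open>tr (C\<^sup>* P C Q) = 0\<close>. The identity is dichotomic; a Clifford gate permutes the Paulis \<open>P\<close>, and a
  projector \<open>G = (1 \<plusminus> Z) / 2\<close> satisfies \<open>G P G = 0\<close> or \<open>G P G = (P \<plusminus> P Z) / 2\<close>, so every circuit is
  dichotomic. For the Choi state this says that each Pauli either stabilizes it up to sign or has
  expectation zero. Expanding a reduced density matrix \<open>\<rho>\<close> on \<open>m\<close> qubits in Paulis gives
  \<open>\<rho>\<^sup>2 = (g / 2\<^sup>m) \<rho>\<close>, where \<open>g\<close> is the number of stabilizers supported there, hence its entropy is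
  \<open>m - log g\<close>. The mutual information is therefore \<open>log |G(A,B)| - log |G(A,{})| - log |G({},B)|\<close>,
  with \<open>G(A,B)\<close> the pairs \<open>(q, p)\<close> supported on \<open>A\<close> and \<open>B\<close> for which \<open>C Q = c P C\<close>. Projecting \<open>G(A,B)\<close>
  to \<open>q\<close> has image the transferable operators and fibres of size \<open>|G({},B)|\<close>, and \<open>G(A,{})\<close> consists of
  the trivial transferable operators, so the quotient is the group whose rank is counted.
\<close>

unbundle bit_operations_syntax

section \<open>Bits and sums over basis states\<close>

lemma qbit_less_2 [simp]: "qbit j i < 2"
  by (simp add: qbit_def)

lemma qbit_cases: "qbit j i = 0 \<or> qbit j i = Suc 0"
  using qbit_less_2[of j i] by linarith

lemma qbit_zero [simp]: "qbit j 0 = 0"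
  by (simp add: qbit_def)

text \<open>The index \<open>r + 2 ^ n * s\<close> concatenates two registers, \<open>r\<close> in
  the low bits and \<open>s\<close> in the high ones. The rule serves the inductions that peel off
  the top qubit as well as the later split of the doubled register into system and
  reference.\<close>

lemma qbit_add_mult:
  assumes "r < 2 ^ n"
  shows "qbit j (r + 2 ^ n * s) = (if j < n then qbit j r else qbit (j - n) s)"
proof (cases "j < n")
  case True
  then obtain d where d: "n = Suc (j + d)" using less_imp_Suc_add by blast
  then have *: "r + 2 ^ n * s = r + 2 ^ j * (2 * (2 ^ d * s))" by (simp add: power_add)
  have "(r + 2 ^ n * s) div 2 ^ j = r div 2 ^ j + 2 * (2 ^ d * s)"
    unfolding * by simp
  then show ?thesis using True by (simp add: qbit_def)
next
  case False
  then have "(2::nat) ^ j = 2 ^ n * 2 ^ (j - n)"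
    by (metis le_add_diff_inverse not_less power_add)
  then have "(r + 2 ^ n * s) div 2 ^ j = s div 2 ^ (j - n)"
    using assms by (simp add: div_mult2_eq)
  then show ?thesis using False by (simp add: qbit_def)
qed

lemma qbit_ge: "i < 2 ^ n \<Longrightarrow> n \<le> j \<Longrightarrow> qbit j i = 0"
  using qbit_add_mult[of i n j 0] by simp

definition of_bits :: "nat \<Rightarrow> (nat \<Rightarrow> nat) \<Rightarrow> nat" where
  "of_bits n b = (\<Sum>j<n. b j * 2 ^ j)"

lemma of_bits_less:
  assumes "\<And>j. j < n \<Longrightarrow> b j < 2"
  shows "of_bits n b < 2 ^ n"
  using assms
proof (induction n)
  case (Suc n)
  have "b n \<le> 1" using Suc.prems[of n] by simp
  then have "b n * 2 ^ n \<le> 1 * (2::nat) ^ n" by (rule mult_right_mono) simp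
  moreover have "of_bits n b < 2 ^ n" using Suc by simp
  moreover have "of_bits (Suc n) b = of_bits n b + b n * 2 ^ n" by (simp add: of_bits_def)
  moreover have "(2::nat) ^ Suc n = 2 ^ n + 2 ^ n" by simp
  ultimately show ?case by linarith
qed (simp add: of_bits_def)

lemma qbit_of_bits:
  assumes "\<And>j. j < n \<Longrightarrow> b j < 2"
  shows "qbit j (of_bits n b) = (if j < n then b j else 0)"
  using assms
proof (induction n)
  case (Suc n)
  have *: "of_bits (Suc n) b = of_bits n b + 2 ^ n * b n"
    by (simp add: of_bits_def)
  have "qbit 0 (b n) = b n" using Suc.prems[of n] by (simp add: qbit_def)
  moreover have "qbit (j - n) (b n) = 0" if "j > n"
    using Suc.prems[of n] that by (intro qbit_ge[of _ 1]) auto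
  ultimately show ?case unfolding *
    using Suc by (subst qbit_add_mult) (auto simp: of_bits_less less_Suc_eq not_less_iff_gr_or_eq)
qed (simp add: of_bits_def)

lemma of_bits_qbit: "i < 2 ^ n \<Longrightarrow> of_bits n (\<lambda>j. qbit j i) = i"
proof (induction n arbitrary: i)
  case (Suc n)
  define r s where "r = i mod 2 ^ n" and "s = i div 2 ^ n"
  have r: "r < 2 ^ n" and i: "i = r + 2 ^ n * s" by (auto simp: r_def s_def)
  have s: "s < 2" using Suc.prems unfolding s_def by (simp add: less_mult_imp_div_less mult.commute)
  have "of_bits (Suc n) (\<lambda>j. qbit j i) = of_bits n (\<lambda>j. qbit j i) + qbit n i * 2 ^ n"
    by (simp add: of_bits_def)
  also have "of_bits n (\<lambda>j. qbit j i) = of_bits n (\<lambda>j. qbit j r)"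
    unfolding i of_bits_def by (intro sum.cong) (auto simp: qbit_add_mult r)
  also have "\<dots> = r" by (rule Suc.IH[OF r])
  also have "qbit n i = s" unfolding i using s by (simp add: qbit_add_mult r) (simp add: qbit_def)
  finally show ?case using i by simp
qed (simp add: of_bits_def)

lemma qbit_eqI:
  assumes "i < 2 ^ n" "k < 2 ^ n" "\<And>j. j < n \<Longrightarrow> qbit j i = qbit j k"
  shows "i = k"
proof -
  have "of_bits n (\<lambda>j. qbit j i) = of_bits n (\<lambda>j. qbit j k)"
    unfolding of_bits_def using assms(3) by (intro sum.cong) auto
  then show ?thesis using of_bits_qbit assms by simp
qed

lemma sum_lessThan_mult:
  "(\<Sum>i<k * (m::nat). f i) = (\<Sum>s<m. \<Sum>r<k. f (r + k * s))"
proof -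
  have *: "sum f {s * k..<s * k + k} = (\<Sum>r<k. f (r + k * s))" for s
    using sum.shift_bounds_nat_ivl[of f 0 "s * k" k]
    by (simp add: add.commute lessThan_atLeast0 mult.commute)
  have "(\<Sum>i<k * m. f i) = (\<Sum>s<m. sum f {s * k..<s * k + k})"
    by (simp add: sum.nat_group mult.commute)
  then show ?thesis unfolding * .
qed

text \<open>Distributivity, one qubit at a time. It reduces products and traces of tensor-product
  matrices to computations on a single qubit.\<close>

lemma sum_prod_qbits:
  fixes f :: "nat \<Rightarrow> nat \<Rightarrow> 'a::comm_semiring_1"
  shows "(\<Sum>r<2 ^ n. \<Prod>j<n. f j (qbit j r)) = (\<Prod>j<n. \<Sum>b<2. f j b)"
proof (induction n)
  case (Suc n)
  have "(\<Sum>r<2 ^ Suc n. \<Prod>j<Suc n. f j (qbit j r))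
      = (\<Sum>s<2. \<Sum>r<2 ^ n. \<Prod>j<Suc n. f j (qbit j (r + 2 ^ n * s)))"
    using sum_lessThan_mult[of _ "2 ^ n" 2] by (simp add: mult.commute)
  also have "\<dots> = (\<Sum>s<2. \<Sum>r<2 ^ n. (\<Prod>j<n. f j (qbit j r)) * f n s)"
  proof (intro sum.cong refl)
    fix s r :: nat assume s: "s \<in> {..<2}" and r: "r \<in> {..<2 ^ n}"
    have "qbit 0 s = s" using s by (simp add: qbit_def)
    then show "(\<Prod>j<Suc n. f j (qbit j (r + 2 ^ n * s))) = (\<Prod>j<n. f j (qbit j r)) * f n s"
      using r by (simp add: qbit_add_mult)
  qed
  also have "\<dots> = (\<Prod>j<n. \<Sum>b<2. f j b) * (\<Sum>s<2. f n s)"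
    by (simp add: sum_distrib_left sum_distrib_right[symmetric] Suc)
  finally show ?case by simp
qed simp

section \<open>Pauli strings\<close>

lemma pauli_string_Suc:
  "{p. pauli_string (Suc n) p} = (\<lambda>(x, p). p(n := x)) ` ({..<4} \<times> {p. pauli_string n p})"
proof (intro equalityI subsetI)
  fix p assume "p \<in> {p. pauli_string (Suc n) p}"
  then have "pauli_string n (p(n := 0))" "p n < 4"
    by (auto simp: pauli_string_def)
  moreover have "p = (\<lambda>(x, p). p(n := x)) (p n, p(n := 0))" by simp
  ultimately show "p \<in> (\<lambda>(x, p). p(n := x)) ` ({..<4} \<times> {p. pauli_string n p})" by blast
qed (auto simp: pauli_string_def)

lemma inj_on_pauli_string_upd:
  "inj_on (\<lambda>(x, p). p(n := x)) ({..<4::nat} \<times> {p. pauli_string n p})"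
proof (intro inj_onI, clarsimp, intro conjI)
  fix x y :: nat and p q
  assume "p(n := x) = q(n := y)" and p: "pauli_string n p" "pauli_string n q"
  then have *: "(p(n := x)) j = (q(n := y)) j" for j by simp
  show "x = y" using *[of n] by simp
  show "p = q"
  proof
    fix j show "p j = q j" using *[of j] p by (cases "j = n") (auto simp: pauli_string_def)
  qed
qed

lemma finite_pauli_strings [simp]: "finite {p. pauli_string n p}"
proof (induction n)
  case 0
  have "{p. pauli_string 0 p} = {\<lambda>_. 0}" by (auto simp: pauli_string_def)
  then show ?case by simp
qed (simp add: pauli_string_Suc)

lemma pauli_string_0: "pauli_string 0 p \<longleftrightarrow> p = (\<lambda>_. 0)"
  by (auto simp: pauli_string_def)

text \<open>The same distributivity over labels instead of basis states; it turns the completeness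
  relation into a single-qubit check.\<close>

lemma sum_prod_pauli_strings:
  fixes f :: "nat \<Rightarrow> nat \<Rightarrow> 'a::comm_semiring_1"
  shows "(\<Sum>p | pauli_string n p. \<Prod>j<n. f j (p j)) = (\<Prod>j<n. \<Sum>x<4. f j x)"
proof (induction n)
  case (Suc n)
  have "(\<Sum>p | pauli_string (Suc n) p. \<Prod>j<Suc n. f j (p j))
      = (\<Sum>(x, p)\<in>{..<4} \<times> {p. pauli_string n p}. (\<Prod>j<n. f j (p j)) * f n x)"
    unfolding pauli_string_Suc
    by (subst sum.reindex[OF inj_on_pauli_string_upd]) (auto intro!: sum.cong prod.cong)
  also have "\<dots> = (\<Sum>x<4. \<Sum>p | pauli_string n p. (\<Prod>j<n. f j (p j)) * f n x)"
    by (rule sum.cartesian_product[symmetric])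
  also have "\<dots> = (\<Prod>j<n. \<Sum>x<4. f j x) * (\<Sum>x<4. f n x)"
    by (simp add: sum_distrib_left sum_distrib_right[symmetric] Suc)
  finally show ?case by simp
qed (simp add: pauli_string_0)

text \<open>With the labels 0 = I, 1 = X, 2 = Y, 3 = Z, multiplication of Paulis up to phase is bitwise xor
  of labels, so that Pauli strings modulo phase form an elementary abelian 2-group.\<close>

definition pxor :: "(nat \<Rightarrow> nat) \<Rightarrow> (nat \<Rightarrow> nat) \<Rightarrow> nat \<Rightarrow> nat" where
  "pxor p q = (\<lambda>j. p j XOR q j)"

lemma pxor_ac: "pxor (pxor p q) r = pxor p (pxor q r)" "pxor p q = pxor q p"
  "pxor q (pxor p r) = pxor p (pxor q r)"
  by (simp_all add: pxor_def ac_simps)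

lemma pxor_self [simp]: "pxor p p = (\<lambda>_. 0)"
  and pxor_0 [simp]: "pxor p (\<lambda>_. 0) = p" "pxor (\<lambda>_. 0) p = p"
  and pxor_cancel [simp]: "pxor p (pxor p q) = q"
  by (simp_all add: pxor_def xor.assoc[symmetric])

lemma less_4_cases: "(x::nat) < 4 \<longleftrightarrow> x = 0 \<or> x = 1 \<or> x = 2 \<or> x = 3"
  by auto

lemma less_2_cases: "(x::nat) < 2 \<longleftrightarrow> x = 0 \<or> x = 1"
  by auto

lemma xor_less_4: "x < 4 \<Longrightarrow> y < 4 \<Longrightarrow> x XOR y < (4::nat)"
  by (auto simp: less_4_cases)

lemma pauli_string_pxor: "pauli_string n p \<Longrightarrow> pauli_string n q \<Longrightarrow> pauli_string n (pxor p q)"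
  by (auto simp: pauli_string_def pxor_def xor_less_4)

lemma pauli_string_zero [simp]: "pauli_string n (\<lambda>_. 0)"
  by (simp add: pauli_string_def)

lemma supported_on_pxor: "supported_on p A \<Longrightarrow> supported_on q A \<Longrightarrow> supported_on (pxor p q) A"
  by (auto simp: supported_on_def pxor_def)

lemma supported_on_zero [simp]: "supported_on (\<lambda>_. 0) A"
  by (simp add: supported_on_def)

text \<open>The cyclic products XY, YZ, ZX carry the phase i and the reversed ones -i, as in XY =
  iZ.\<close>

definition phase1 :: "nat \<Rightarrow> nat \<Rightarrow> complex" where
  "phase1 x y = (if x = 0 \<or> y = 0 \<or> x = y then 1
     else if (x, y) \<in> {(1, 2), (2, 3), (3, 1)} then \<i> else - \<i>)"

lemma sum_less_2: "(\<Sum>b<(2::nat). f b) = f 0 + f 1"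
  by (simp add: numeral_2_eq_2)

lemma sum_less_4: "(\<Sum>b<(4::nat). f b) = f 0 + f 1 + f 2 + f 3"
  by (simp add: eval_nat_numeral)

lemma pauli1_mult:
  assumes "x < 4" "y < 4" "a < 2" "b < 2"
  shows "(\<Sum>m<2. pauli1 x a m * pauli1 y m b) = phase1 x y * pauli1 (x XOR y) a b"
  using assms unfolding sum_less_2 less_4_cases less_2_cases
  by (elim disjE; simp add: pauli1_def phase1_def)

lemma smult_smult_mat [simp]: "a \<cdot>\<^sub>m (b \<cdot>\<^sub>m A) = (a * b :: 'a :: semigroup_mult) \<cdot>\<^sub>m A"
  by (rule eq_matI) (auto simp: mult.assoc)

lemma one_smult_mat [simp]: "(1 :: 'a :: monoid_mult) \<cdot>\<^sub>m A = A"
  by (rule eq_matI) auto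

lemma pauli_mat_carrier [simp]: "pauli_mat n p \<in> carrier_mat (2 ^ n) (2 ^ n)"
  by (simp add: pauli_mat_def)

lemma pauli_mat_dim [simp]: "dim_row (pauli_mat n p) = 2 ^ n" "dim_col (pauli_mat n p) = 2 ^ n"
  by (simp_all add: pauli_mat_def)

definition pauli_phase :: "nat \<Rightarrow> (nat \<Rightarrow> nat) \<Rightarrow> (nat \<Rightarrow> nat) \<Rightarrow> complex" where
  "pauli_phase n p q = (\<Prod>j<n. phase1 (p j) (q j))"

lemma phase1_cases: "phase1 x y \<in> phases"
  by (auto simp: phase1_def phases_def)

lemma phases_mult: "a \<in> phases \<Longrightarrow> b \<in> phases \<Longrightarrow> a * b \<in> phases"
  by (auto simp: phases_def)

lemma pauli_phase_in: "pauli_phase n p q \<in> phases"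
  unfolding pauli_phase_def
  by (induction n) (auto intro!: phases_mult phase1_cases, simp add: phases_def)

lemma phases_nonzero: "c \<in> phases \<Longrightarrow> c \<noteq> 0"
  by (auto simp: phases_def)

lemma pauli_phase_nonzero [simp]: "pauli_phase n p q \<noteq> 0"
  using pauli_phase_in phases_nonzero by blast

text \<open>An entry of the product is a sum over basis states of a product over sites, so it
  factorizes into the single-qubit multiplication table.\<close>

lemma pauli_mult:
  assumes "pauli_string n p" "pauli_string n q"
  shows "pauli_mat n p * pauli_mat n q = pauli_phase n p q \<cdot>\<^sub>m pauli_mat n (pxor p q)"
proof (rule eq_matI)
  fix r c assume "r < dim_row (pauli_phase n p q \<cdot>\<^sub>m pauli_mat n (pxor p q))"
    "c < dim_col (pauli_phase n p q \<cdot>\<^sub>m pauli_mat n (pxor p q))"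
  then have rc: "r < 2 ^ n" "c < 2 ^ n" by auto
  have "(pauli_mat n p * pauli_mat n q) $$ (r, c)
     = (\<Sum>m<2 ^ n. (\<Prod>j<n. pauli1 (p j) (qbit j r) (qbit j m) * pauli1 (q j) (qbit j m) (qbit j c)))"
    using rc by (simp add: scalar_prod_def pauli_mat_def prod.distrib lessThan_atLeast0)
  also have "\<dots> = (\<Prod>j<n. \<Sum>b<2. pauli1 (p j) (qbit j r) b * pauli1 (q j) b (qbit j c))"
    by (rule sum_prod_qbits)
  also have "\<dots> = (\<Prod>j<n. phase1 (p j) (q j) * pauli1 (p j XOR q j) (qbit j r) (qbit j c))"
    using assms by (intro prod.cong refl pauli1_mult) (auto simp: pauli_string_def)
  finally show "(pauli_mat n p * pauli_mat n q) $$ (r, c)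
      = (pauli_phase n p q \<cdot>\<^sub>m pauli_mat n (pxor p q)) $$ (r, c)"
    using rc by (simp add: pauli_mat_def pauli_phase_def prod.distrib pxor_def)
qed auto

text \<open>At each site the phases of the two orders differ by a factor 1 or -1, and the global
  sign is the product of these ratios.\<close>

lemma pauli_commute:
  assumes "pauli_string n p" "pauli_string n q"
  obtains s where "s = 1 \<or> s = -1" "pauli_mat n p * pauli_mat n q = s \<cdot>\<^sub>m (pauli_mat n q * pauli_mat n p)"
proof -
  define t where "t j = phase1 (p j) (q j) / phase1 (q j) (p j)" for j
  have t: "t j = 1 \<or> t j = -1" for j by (auto simp: t_def phase1_def)
  have "(\<Prod>j<n. t j) = 1 \<or> (\<Prod>j<n. t j) = -1"
    by (induction n) (use t in auto, (metis minus_mult_right mult.right_neutral minus_minus)+)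
  moreover have "pauli_phase n p q = (\<Prod>j<n. t j) * pauli_phase n q p"
    unfolding pauli_phase_def prod.distrib[symmetric] t_def
    using phases_nonzero[OF phase1_cases] by (intro prod.cong) auto
  ultimately show ?thesis
    using assms by (intro that[of "\<Prod>j<n. t j"])
      (auto simp: pauli_mult pxor_ac(2)[of q p] smult_smult_mat)
qed

lemma pauli_mat_zero: "pauli_mat n (\<lambda>_. 0) = 1\<^sub>m (2 ^ n)"
proof (rule eq_matI)
  fix r c assume "r < dim_row (1\<^sub>m (2 ^ n))" "c < dim_col (1\<^sub>m (2 ^ n))"
  then have rc: "r < 2 ^ n" "c < 2 ^ n" by auto
  show "pauli_mat n (\<lambda>_. 0) $$ (r, c) = 1\<^sub>m (2 ^ n) $$ (r, c)"
    using rc qbit_eqI[OF rc] by (auto simp: pauli_mat_def pauli1_def)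
qed auto

lemma pauli_square: "pauli_string n p \<Longrightarrow> pauli_mat n p * pauli_mat n p = 1\<^sub>m (2 ^ n)"
  by (auto simp: pauli_mult pauli_mat_zero pauli_phase_def phase1_def)

section \<open>Trace orthogonality, transposition and completeness of Pauli matrices\<close>

definition mtrace :: "'a::comm_semiring_1 mat \<Rightarrow> 'a" where
  "mtrace A = (\<Sum>i<dim_row A. A $$ (i, i))"

lemma mtrace_comm:
  assumes "A \<in> carrier_mat n m" "B \<in> carrier_mat m n"
  shows "mtrace (A * B) = mtrace (B * A)"
proof -
  have "mtrace (A * B) = (\<Sum>i<n. \<Sum>j<m. A $$ (i, j) * B $$ (j, i))"
    using assms by (auto simp: mtrace_def scalar_prod_def lessThan_atLeast0 intro!: sum.cong)
  also have "\<dots> = (\<Sum>j<m. \<Sum>i<n. B $$ (j, i) * A $$ (i, j))"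
    by (subst sum.swap) (simp add: mult.commute)
  also have "\<dots> = mtrace (B * A)"
    using assms by (auto simp: mtrace_def scalar_prod_def lessThan_atLeast0 intro!: sum.cong)
  finally show ?thesis .
qed

lemma mtrace_smult: "mtrace (c \<cdot>\<^sub>m A) = c * mtrace A" if "A \<in> carrier_mat n n"
  using that by (auto simp: mtrace_def sum_distrib_left)

text \<open>The trace is a product of single-site traces, and X, Y, Z are traceless.\<close>

lemma mtrace_pauli:
  assumes "pauli_string n p"
  shows "mtrace (pauli_mat n p) = (if p = (\<lambda>_. 0) then 2 ^ n else 0)"
proof -
  have "mtrace (pauli_mat n p) = (\<Sum>r<2 ^ n. \<Prod>j<n. pauli1 (p j) (qbit j r) (qbit j r))"
    by (simp add: mtrace_def pauli_mat_def)
  also have "\<dots> = (\<Prod>j<n. \<Sum>b<2. pauli1 (p j) b b)"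
    by (rule sum_prod_qbits)
  also have "\<dots> = (if p = (\<lambda>_. 0) then 2 ^ n else 0)"
  proof (cases "p = (\<lambda>_. 0)")
    case True
    then show ?thesis by (simp add: pauli1_def)
  next
    case False
    then obtain j where "p j \<noteq> 0" by auto
    moreover from this have "j < n" "p j < 4" using assms by (auto simp: pauli_string_def not_less[symmetric])
    ultimately have "(\<Sum>b<2. pauli1 (p j) b b) = 0"
      by (auto simp: sum_less_2 pauli1_def)
    then show ?thesis using False \<open>j < n\<close> by auto
  qed
  finally show ?thesis .
qed

text \<open>Multiplying by \<open>pauli_mat n p\<close> makes the identity a multiple of the Pauli
  matrix labelled \<open>pxor p q\<close>, which is traceless unless the labels agree.\<close>

lemma pauli_mat_inj:
  assumes p: "pauli_string n p" "pauli_string n q" and eq: "pauli_mat n p = c \<cdot>\<^sub>m pauli_mat n q"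
  shows "p = q"
proof (rule ccontr)
  assume "p \<noteq> q"
  then have ne: "pxor p q \<noteq> (\<lambda>_. 0)" by (metis pxor_cancel pxor_0(1))
  have "1\<^sub>m (2 ^ n) = pauli_mat n p * (c \<cdot>\<^sub>m pauli_mat n q)"
    using pauli_square[OF p(1)] eq by simp
  also have "\<dots> = (c * pauli_phase n p q) \<cdot>\<^sub>m pauli_mat n (pxor p q)"
    by (simp add: pauli_mult p mult_smult_distrib[of _ "2^n" "2^n" _ "2^n"] smult_smult_mat)
  finally have "mtrace (1\<^sub>m (2 ^ n)) = c * pauli_phase n p q * mtrace (pauli_mat n (pxor p q))"
    by (simp add: mtrace_smult[of _ "2 ^ n"])
  then show False
    using ne by (simp add: mtrace_pauli pauli_string_pxor p) (simp add: mtrace_def)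
qed

text \<open>The sign of transposition: Y is the only antisymmetric single-qubit Pauli. It appears
  when an operator on the reference half of the Choi state is rewritten as acting on
  \<open>C\<close> from the right.\<close>

definition pauli_tsign :: "nat \<Rightarrow> (nat \<Rightarrow> nat) \<Rightarrow> complex" where
  "pauli_tsign n p = (\<Prod>j<n. if p j = 2 then -1 else 1)"

lemma pauli_tsign_nonzero [simp]: "pauli_tsign n p \<noteq> 0"
  by (simp add: pauli_tsign_def)

lemma pauli_transpose: "pauli_mat n p $$ (r, c) = pauli_tsign n p * pauli_mat n p $$ (c, r)"
  if "r < 2 ^ n" "c < 2 ^ n"
proof -
  have *: "pauli1 x a b = (if x = 2 then -1 else 1) * pauli1 x b a" for x a b
    by (simp add: pauli1_def)
  have "pauli_mat n p $$ (r, c) = (\<Prod>j<n. pauli1 (p j) (qbit j r) (qbit j c))"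
    using that by (simp add: pauli_mat_def)
  also have "\<dots> = (\<Prod>j<n. (if p j = 2 then -1 else 1) * pauli1 (p j) (qbit j c) (qbit j r))"
    by (intro prod.cong refl *)
  finally show ?thesis
    using that by (simp add: pauli_mat_def pauli_tsign_def prod.distrib)
qed

lemma dagger_carrier [simp]: "A \<in> carrier_mat n m \<Longrightarrow> dagger A \<in> carrier_mat m n"
  by (auto simp: dagger_def)

lemma dagger_pauli: "dagger (pauli_mat n p) = pauli_mat n p"
proof -
  have "cnj (pauli1 x b a) = pauli1 x a b" for x a b by (simp add: pauli1_def)
  then show ?thesis by (auto simp: dagger_def pauli_mat_def)
qed

text \<open>On one qubit the sum of P tensor P over all labels is twice the swap, and the sum over
  strings factorizes over sites. This is the inversion formula behind the expansion of a matrix in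
  Paulis.\<close>

lemma pauli_completeness:
  assumes "k < 2 ^ n" "l < 2 ^ n" "a < 2 ^ n" "b < 2 ^ n"
  shows "(\<Sum>p | pauli_string n p. pauli_mat n p $$ (k, l) * pauli_mat n p $$ (a, b))
    = (if k = b \<and> l = a then 2 ^ n else 0)"
proof -
  have single: "(\<Sum>x<4. pauli1 x u v * pauli1 x w z) = (if u = z \<and> v = w then 2 else 0)"
    if "u < 2" "v < 2" "w < 2" "z < 2" for u v w z
    using that unfolding sum_less_4 by (auto simp: less_2_cases pauli1_def)
  have "(\<Sum>p | pauli_string n p. pauli_mat n p $$ (k, l) * pauli_mat n p $$ (a, b))
     = (\<Sum>p | pauli_string n p. \<Prod>j<n. pauli1 (p j) (qbit j k) (qbit j l) * pauli1 (p j) (qbit j a) (qbit j b))"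
    using assms by (simp add: pauli_mat_def prod.distrib)
  also have "\<dots> = (\<Prod>j<n. \<Sum>x<4. pauli1 x (qbit j k) (qbit j l) * pauli1 x (qbit j a) (qbit j b))"
    by (rule sum_prod_pauli_strings)
  also have "\<dots> = (\<Prod>j<n. if qbit j k = qbit j b \<and> qbit j l = qbit j a then 2 else 0)"
    by (simp add: single)
  also have "\<dots> = (if k = b \<and> l = a then 2 ^ n else 0)"
  proof (cases "k = b \<and> l = a")
    case False
    then obtain j where "j < n" "qbit j k \<noteq> qbit j b \<or> qbit j l \<noteq> qbit j a"
      using qbit_eqI[OF assms(1,4)] qbit_eqI[OF assms(2,3)] by blast
    then show ?thesis using False by auto
  qed simp
  finally show ?thesis .
qed

section \<open>Entropy of a scaled projector\<close>

lemma order_prod_linear: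
  "Polynomial.order a (\<Prod>b\<leftarrow>as. [:- b, 1:]) = count_list as (a :: 'a :: idom)"
proof (induction as)
  case (Cons b as)
  have "(\<Prod>b\<leftarrow>as. [:- b, 1:]) \<noteq> 0" by (auto simp: prod_list_zero_iff)
  moreover have "Polynomial.order a [:- b, 1:] = (if a = b then 1 else 0)"
    using order_power_n_n[of a 1] by (auto intro: order_0I)
  ultimately show ?case using Cons by (simp add: order_mult del: mult_pCons_left)
qed simp

lemma poly_prod_linear_eq_0:
  "poly (\<Prod>b\<leftarrow>as. [:- b, 1:]) a = 0 \<longleftrightarrow> a \<in> set (as :: 'a :: idom list)"
  by (induction as) auto

text \<open>Schur triangularization is a similarity, which keeps the trace by cyclicity, and it puts
  the eigenvalues on the diagonal.\<close>

lemma mtrace_eq_sum_eigenvalues: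
  fixes M :: "complex mat"
  assumes M: "M \<in> carrier_mat n n" and cp: "char_poly M = (\<Prod>a\<leftarrow>as. [:- a, 1:])"
  shows "mtrace M = sum_list as"
proof -
  obtain B P Q where "schur_decomposition M as = (B, P, Q)" by (metis prod_cases3)
  from schur_decomposition[OF M cp this]
  have sim: "similar_mat_wit M B P Q" and diag: "diag_mat B = as" by auto
  note w = similar_mat_witD2[OF M sim]
  have "mtrace M = mtrace (P * (B * Q))"
    using w by (simp add: assoc_mult_mat[of _ n n _ n _ n])
  also have "\<dots> = mtrace (B * Q * P)"
    using w by (intro mtrace_comm[of _ n n]) auto
  also have "B * Q * P = B"
    using w by (simp add: assoc_mult_mat[of _ n n _ n _ n])
  also have "mtrace B = sum_list (diag_mat B)"
    using w by (simp add: mtrace_def diag_mat_def interv_sum_list_conv_sum_set_nat lessThan_atLeast0)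
  finally show ?thesis using diag by simp
qed

text \<open>The quadratic equation confines the eigenvalues to \<open>0\<close> and
  \<open>l\<close>, and unit trace forces \<open>l\<close> to occur \<open>1 / l\<close> times; the
  entropy is then \<open>1 / l\<close> copies of \<open>- l * log 2 l\<close>.\<close>

lemma vn_entropy_scaled_projector:
  assumes M: "M \<in> carrier_mat n n" and sq: "M * M = complex_of_real l \<cdot>\<^sub>m M"
    and tr: "mtrace M = 1" and l: "l > 0"
  shows "vn_entropy M = - log 2 l"
proof -
  obtain as where cp: "char_poly M = (\<Prod>a\<leftarrow>as. [:- a, 1:])"
    using char_poly_factorized[OF M] by blast
  have roots: "{a. poly (char_poly M) a = 0} = set as"
    by (auto simp: cp poly_prod_linear_eq_0)
  have sub: "set as \<subseteq> {0, complex_of_real l}"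
  proof
    fix a assume "a \<in> set as"
    then have "eigenvalue M a"
      using roots by (subst eigenvalue_root_char_poly[OF M]) auto
    then obtain v where v: "v \<in> carrier_vec n" "v \<noteq> 0\<^sub>v n" "M *\<^sub>v v = a \<cdot>\<^sub>v v"
      using M by (auto simp: eigenvalue_def eigenvector_def)
    have "(M * M) *\<^sub>v v = M *\<^sub>v (M *\<^sub>v v)"
      using M v by (intro assoc_mult_mat_vec) auto
    also have "\<dots> = (a * a) \<cdot>\<^sub>v v"
      using M v by (simp add: mult_mat_vec smult_smult_assoc)
    finally have "(complex_of_real l \<cdot>\<^sub>m M) *\<^sub>v v = (a * a) \<cdot>\<^sub>v v"
      by (simp add: sq)
    moreover have "(complex_of_real l \<cdot>\<^sub>m M) *\<^sub>v v = complex_of_real l \<cdot>\<^sub>v (M *\<^sub>v v)"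
      using M v(1) by (intro eq_vecI) auto
    ultimately have eq: "(complex_of_real l * a) \<cdot>\<^sub>v v = (a * a) \<cdot>\<^sub>v v"
      using v by (simp add: smult_smult_assoc)
    obtain i where i: "i < n" "v $ i \<noteq> 0"
      using v by (metis carrier_vecD eq_vecI index_zero_vec)
    have "complex_of_real l * a * v $ i = a * a * v $ i"
      using arg_cong[OF eq, of "\<lambda>w. w $ i"] i v by simp
    then show "a \<in> {0, complex_of_real l}" using i by auto
  qed
  have "sum_list as = of_nat (count_list as (complex_of_real l)) * complex_of_real l"
    using sub l by (induction as) (auto simp: algebra_simps)
  then have "of_nat (count_list as (complex_of_real l)) * complex_of_real l = 1"
    using tr mtrace_eq_sum_eigenvalues[OF M cp] by simp
  then have "complex_of_real (real (count_list as (complex_of_real l)) * l) = 1" by simp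
  then have cnt: "real (count_list as (complex_of_real l)) * l = 1"
    by (simp only: of_real_eq_1_iff)
  have "vn_entropy M = (\<Sum>a\<in>set as. real (count_list as a) * ent_fun (Re a))"
    unfolding vn_entropy_def roots unfolding cp order_prod_linear ..
  \<comment> \<open>Members of the pair that are not eigenvalues have multiplicity zero, so summing
    over the full pair is harmless.\<close>
  also have "\<dots> = (\<Sum>a\<in>{0, complex_of_real l}. real (count_list as a) * ent_fun (Re a))"
    by (intro sum.mono_neutral_left sub) (auto simp: count_list_0_iff)
  also have "\<dots> = (real (count_list as (complex_of_real l)) * l) * (- log 2 l)"
    using l by (simp add: ent_fun_def)
  finally show ?thesis using cnt by simp
qed

section \<open>Reduced density matrices\<close>

text \<open>Carries bits or Pauli labels from positions in \<open>xs\<close> to the sites listed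
  there. The form as a sum lets it be exchanged with the sum in \<open>of_bits\<close>; for distinct
  \<open>xs\<close> at most one term survives.\<close>

definition scatter :: "nat list \<Rightarrow> (nat \<Rightarrow> nat) \<Rightarrow> nat \<Rightarrow> nat" where
  "scatter xs f j = (\<Sum>m<length xs. if xs ! m = j then f m else 0)"

lemma scatter_nth:
  assumes "distinct xs" "m < length xs"
  shows "scatter xs f (xs ! m) = f m"
proof -
  have "scatter xs f (xs ! m) = (\<Sum>i<length xs. if i = m then f i else 0)"
    unfolding scatter_def using assms by (intro sum.cong) (auto simp: nth_eq_iff_index_eq)
  then show ?thesis using assms by simp
qed

lemma scatter_notin: "j \<notin> set xs \<Longrightarrow> scatter xs f j = 0"
  by (auto simp: scatter_def)

lemma place_bits_eq_of_bits:
  assumes "set xs \<subseteq> {..<N}"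
  shows "place_bits xs k = of_bits N (scatter xs (\<lambda>m. qbit m k))"
proof -
  have "of_bits N (scatter xs (\<lambda>m. qbit m k))
      = (\<Sum>j<N. \<Sum>m<length xs. (if xs ! m = j then qbit m k * 2 ^ j else 0))"
    unfolding of_bits_def scatter_def sum_distrib_right by (intro sum.cong) auto
  also have "\<dots> = (\<Sum>m<length xs. \<Sum>j<N. (if xs ! m = j then qbit m k * 2 ^ j else 0))"
    by (rule sum.swap)
  also have "\<dots> = place_bits xs k"
    unfolding place_bits_def
  proof (intro sum.cong refl)
    fix m assume "m \<in> {..<length xs}"
    then have "xs ! m < N" using assms nth_mem by blast
    then show "(\<Sum>j<N. if xs ! m = j then qbit m k * 2 ^ j else 0) = qbit m k * 2 ^ (xs ! m)"
      by simp
  qed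
  finally show ?thesis by simp
qed

text \<open>\<open>xs\<close> lists the qubits that are kept and \<open>ys\<close> those that are
  traced out; the order within each list fixes the bit order of the subsystem indices.\<close>

locale bipartition =
  fixes N :: nat and xs ys :: "nat list"
  assumes dist: "distinct (xs @ ys)" and cover: "set (xs @ ys) = {..<N}"
begin

lemma length_add: "length xs + length ys = N"
  using distinct_card[OF dist] cover by simp

definition join :: "nat \<Rightarrow> nat \<Rightarrow> nat" where
  "join k e = place_bits xs k + place_bits ys e"

lemma join_eq_of_bits:
  "join k e = of_bits N (\<lambda>j. scatter xs (\<lambda>m. qbit m k) j + scatter ys (\<lambda>m. qbit m e) j)"
proof -
  have "set xs \<subseteq> {..<N}" "set ys \<subseteq> {..<N}" using cover by auto
  then show ?thesis
    by (simp add: join_def place_bits_eq_of_bits of_bits_def sum.distrib add_mult_distrib)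
qed

lemma nth_less:
  "m < length xs \<Longrightarrow> xs ! m < N"
  "m < length ys \<Longrightarrow> ys ! m < N"
proof -
  have "set xs \<subseteq> {..<N}" "set ys \<subseteq> {..<N}" using cover by auto
  then show "m < length xs \<Longrightarrow> xs ! m < N" "m < length ys \<Longrightarrow> ys ! m < N"
    using nth_mem by blast+
qed

lemma nth_cases:
  assumes "j < N"
  obtains m where "m < length xs" "j = xs ! m" | m where "m < length ys" "j = ys ! m"
proof -
  have "j \<in> set xs \<or> j \<in> set ys" using assms cover by auto
  then show ?thesis using that by (metis in_set_conv_nth)
qed

lemma scatter_ys: "m < length ys \<Longrightarrow> scatter xs f (ys ! m) = 0"
  using dist by (intro scatter_notin) (auto dest: nth_mem)

lemma scatter_xs: "m < length xs \<Longrightarrow> scatter ys f (xs ! m) = 0"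
  using dist by (intro scatter_notin) (auto dest: nth_mem)

lemma scatter_add:
  "m < length xs \<Longrightarrow> scatter xs f (xs ! m) + scatter ys g (xs ! m) = f m"
  "m < length ys \<Longrightarrow> scatter xs f (ys ! m) + scatter ys g (ys ! m) = g m"
  using dist by (simp_all add: scatter_nth scatter_xs scatter_ys)

lemma scatter_add_less: "j < N \<Longrightarrow> scatter xs (\<lambda>m. qbit m k) j + scatter ys (\<lambda>m. qbit m e) j < 2"
  by (erule nth_cases) (simp_all add: scatter_add)

lemma join_less: "join k e < 2 ^ N"
  unfolding join_eq_of_bits by (intro of_bits_less scatter_add_less)

lemma qbit_join:
  "m < length xs \<Longrightarrow> qbit (xs ! m) (join k e) = qbit m k"
  "m < length ys \<Longrightarrow> qbit (ys ! m) (join k e) = qbit m e"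
  unfolding join_eq_of_bits
  by (subst qbit_of_bits; simp add: scatter_add scatter_add_less nth_less)+

lemma join_eq_iff:
  assumes "k < 2 ^ length xs" "k' < 2 ^ length xs" "e < 2 ^ length ys" "e' < 2 ^ length ys"
  shows "join k e = join k' e' \<longleftrightarrow> k = k' \<and> e = e'"
proof
  assume eq: "join k e = join k' e'"
  have "k = k'"
    by (rule qbit_eqI[OF assms(1,2)]) (metis eq qbit_join(1))
  moreover have "e = e'"
    by (rule qbit_eqI[OF assms(3,4)]) (metis eq qbit_join(2))
  ultimately show "k = k' \<and> e = e'" ..
qed auto

text \<open>\<open>join\<close> is a bijection onto the basis indices: injective because the bits of
  both arguments can be read off, surjective by counting.\<close>

lemma sum_join: "(\<Sum>i<2 ^ N. f i) = (\<Sum>k<2 ^ length xs. \<Sum>e<2 ^ length ys. f (join k e))"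
proof -
  let ?D = "{..<2 ^ length xs} \<times> {..<2 ^ length ys}"
  have inj: "inj_on (\<lambda>(k, e). join k e) ?D"
    by (auto simp: inj_on_def join_eq_iff)
  have "(\<lambda>(k, e). join k e) ` ?D = {..<2 ^ N}"
  proof (rule card_subset_eq)
    show "card ((\<lambda>(k, e). join k e) ` ?D) = card {..<2 ^ N :: nat}"
      by (simp add: card_image[OF inj] length_add[symmetric] power_add)
  qed (auto simp: join_less)
  then have "(\<Sum>i<2 ^ N. f i) = (\<Sum>(k, e)\<in>?D. f (join k e))"
    using sum.reindex[OF inj, of f] by (simp add: case_prod_unfold)
  then show ?thesis by (simp add: sum.cartesian_product)
qed

lemma prod_split:
  "(\<Prod>j<N. g j) = (\<Prod>m<length xs. g (xs ! m)) * (\<Prod>m<length ys. g (ys ! m))"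
proof -
  have nth: "(\<Prod>j\<in>set zs. g j) = (\<Prod>m<length zs. g (zs ! m))" if "distinct zs" for zs
    using prod.reindex_bij_betw[OF bij_betw_nth[OF that refl refl], of g] by simp
  have "(\<Prod>j<N. g j) = (\<Prod>j\<in>set xs. g j) * (\<Prod>j\<in>set ys. g j)"
    unfolding cover[symmetric] set_append using dist by (intro prod.union_disjoint) auto
  then show ?thesis using dist by (simp add: nth)
qed

text \<open>In the split basis the scattered string is P tensor 1: each site of \<open>ys\<close>
  has label 0, whose factor is a Kronecker delta.\<close>

lemma pauli_mat_scatter:
  assumes "k < 2 ^ length xs" "k' < 2 ^ length xs" "e < 2 ^ length ys" "e' < 2 ^ length ys"
  shows "pauli_mat N (scatter xs p) $$ (join k e, join k' e')
    = (if e = e' then pauli_mat (length xs) p $$ (k, k') else 0)"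
proof -
  have "pauli_mat N (scatter xs p) $$ (join k e, join k' e')
     = (\<Prod>m<length xs. pauli1 (p m) (qbit m k) (qbit m k'))
       * (\<Prod>m<length ys. if qbit m e = qbit m e' then 1 else 0)"
    using dist
    by (auto simp: pauli_mat_def join_less prod_split scatter_nth scatter_ys qbit_join pauli1_def[of 0]
        intro!: arg_cong2[where f = "(*)"] prod.cong)
  also have "(\<Prod>m<length ys. if qbit m e = qbit m e' then 1 else 0) = (if e = e' then 1 else (0 :: complex))"
    using qbit_eqI[OF assms(3,4)] by auto
  finally show ?thesis using assms by (auto simp: pauli_mat_def)
qed

lemma bij_scatter:
  "bij_betw (scatter xs) {p. pauli_string (length xs) p} {p. pauli_string N p \<and> supported_on p (set xs)}"
proof (rule bij_betwI[where g = "\<lambda>p m. if m < length xs then p (xs ! m) else 0"])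
  have d: "distinct xs" using dist by simp
  show "scatter xs \<in> {p. pauli_string (length xs) p} \<rightarrow> {p. pauli_string N p \<and> supported_on p (set xs)}"
  proof safe
    fix p assume p: "pauli_string (length xs) p"
    show "supported_on (scatter xs p) (set xs)" by (auto simp: supported_on_def scatter_notin)
    show "pauli_string N (scatter xs p)"
      unfolding pauli_string_def
    proof (intro conjI allI impI)
      fix j assume "j < N"
      then show "scatter xs p j < 4"
        by (cases "j \<in> set xs") (use p d in \<open>auto simp: in_set_conv_nth scatter_nth scatter_notin pauli_string_def\<close>)
    next
      fix j assume "N \<le> j"
      then have "j \<notin> set (xs @ ys)" unfolding cover by simp
      then show "scatter xs p j = 0" by (intro scatter_notin) simp
    qed
  qed
  show "(\<lambda>p m. if m < length xs then p (xs ! m) else 0)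
    \<in> {p. pauli_string N p \<and> supported_on p (set xs)} \<rightarrow> {p. pauli_string (length xs) p}"
    using nth_less by (auto simp: pauli_string_def)
  show "(\<lambda>m. if m < length xs then scatter xs p (xs ! m) else 0) = p"
    if "p \<in> {p. pauli_string (length xs) p}" for p
    using that d by (auto simp: scatter_nth pauli_string_def)
  show "scatter xs (\<lambda>m. if m < length xs then p (xs ! m) else 0) = p"
    if p: "p \<in> {p. pauli_string N p \<and> supported_on p (set xs)}" for p
  proof
    fix j
    show "scatter xs (\<lambda>m. if m < length xs then p (xs ! m) else 0) j = p j"
      by (cases "j \<in> set xs") (use p d in \<open>auto simp: in_set_conv_nth scatter_nth scatter_notin supported_on_def\<close>)
  qed
qed

end

section \<open>Entropy of a reduced state from its stabilizers\<close>

definition pauli_apply :: "nat \<Rightarrow> (nat \<Rightarrow> nat) \<Rightarrow> (nat \<Rightarrow> complex) \<Rightarrow> nat \<Rightarrow> complex" where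
  "pauli_apply N p psi r = (\<Sum>c<2 ^ N. pauli_mat N p $$ (r, c) * psi c)"

definition pauli_eigen :: "nat \<Rightarrow> (nat \<Rightarrow> complex) \<Rightarrow> (nat \<Rightarrow> nat) \<Rightarrow> complex \<Rightarrow> bool" where
  "pauli_eigen N psi p t \<longleftrightarrow> (\<forall>r<2 ^ N. pauli_apply N p psi r = t * psi r)"

definition pauli_expect :: "nat \<Rightarrow> (nat \<Rightarrow> complex) \<Rightarrow> (nat \<Rightarrow> nat) \<Rightarrow> complex" where
  "pauli_expect N psi p = (\<Sum>r<2 ^ N. cnj (psi r) * pauli_apply N p psi r)"

text \<open>The elements are labels without sign: the eigenvalue \<open>t\<close> absorbs it, so
  that P and -P are not counted separately.\<close>

definition stabilizer_labels :: "nat \<Rightarrow> (nat \<Rightarrow> complex) \<Rightarrow> nat set \<Rightarrow> (nat \<Rightarrow> nat) set" where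
  "stabilizer_labels N psi X = {p. pauli_string N p \<and> supported_on p X \<and> (\<exists>t. pauli_eigen N psi p t)}"

text \<open>Only this dichotomy is needed to call a state a stabilizer state: the purity of the state forces the
  number of stabilizers to be maximal.\<close>

definition pauli_dichotomy :: "nat \<Rightarrow> (nat \<Rightarrow> complex) \<Rightarrow> bool" where
  "pauli_dichotomy N psi \<longleftrightarrow>
     (\<forall>p. pauli_string N p \<longrightarrow> (\<exists>t. pauli_eigen N psi p t) \<or> pauli_expect N psi p = 0)"

text \<open>The numbers \<open>w p\<close> are the Pauli coefficients of \<open>rho\<close>. By the
  dichotomy they vanish off \<open>G\<close>, while on \<open>G\<close> they are signs and
  eigenvalues of P on \<open>rho\<close>. Expanding one factor of \<open>rho * rho\<close> therefore
  gives \<open>card G\<close> equal terms, and the scaled-projector formula applies.\<close>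

lemma (in bipartition) entropy_partial_trace:
  assumes norm: "(\<Sum>i<2 ^ N. psi i * cnj (psi i)) = 1" and dich: "pauli_dichotomy N psi"
    and rho: "rho = mat (2 ^ length xs) (2 ^ length xs) (\<lambda>(k, k').
        \<Sum>e<2 ^ length ys. psi (join k e) * cnj (psi (join k' e)))"
  shows "vn_entropy rho = real (length xs) - log 2 (real (card (stabilizer_labels N psi (set xs))))"
proof -
  let ?m = "length xs"
  define w where "w p = mtrace (pauli_mat ?m p * rho)" for p
  define G where "G = {p. pauli_string ?m p \<and> (\<exists>t. pauli_eigen N psi (scatter xs p) t)}"
  have carr: "rho \<in> carrier_mat (2 ^ ?m) (2 ^ ?m)" by (simp add: rho)
  have tr: "mtrace rho = 1"
    using norm by (simp add: mtrace_def rho sum_join)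
  \<comment> \<open>A Pauli on the kept qubits leaves the environment index \<open>e\<close>
    alone.\<close>
  have apply_join: "pauli_apply N (scatter xs p) psi (join k e)
      = (\<Sum>k'<2 ^ ?m. pauli_mat ?m p $$ (k, k') * psi (join k' e))"
    if "k < 2 ^ ?m" "e < 2 ^ length ys" for p k e
  proof -
    have "pauli_apply N (scatter xs p) psi (join k e)
      = (\<Sum>k'<2 ^ ?m. \<Sum>e'<2 ^ length ys. (if e = e' then pauli_mat ?m p $$ (k, k') else 0) * psi (join k' e'))"
      unfolding pauli_apply_def sum_join using that by (intro sum.cong refl) (auto simp: pauli_mat_scatter)
    also have "\<dots> = (\<Sum>k'<2 ^ ?m. \<Sum>e'<2 ^ length ys. if e = e' then pauli_mat ?m p $$ (k, k') * psi (join k' e') else 0)"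
      by (intro sum.cong) auto
    finally show ?thesis using that by simp
  qed
  have mult_rho: "(pauli_mat ?m p * rho) $$ (k, l)
     = (\<Sum>e<2 ^ length ys. pauli_apply N (scatter xs p) psi (join k e) * cnj (psi (join l e)))"
    if "k < 2 ^ ?m" "l < 2 ^ ?m" for p k l
  proof -
    have "(pauli_mat ?m p * rho) $$ (k, l)
       = (\<Sum>k'<2 ^ ?m. \<Sum>e<2 ^ length ys. pauli_mat ?m p $$ (k, k') * psi (join k' e) * cnj (psi (join l e)))"
      using that by (simp add: rho scalar_prod_def lessThan_atLeast0 sum_distrib_left mult.assoc)
    then show ?thesis
      by (subst (asm) sum.swap) (use that in \<open>simp add: apply_join sum_distrib_right\<close>)
  qed
  have eig: "pauli_mat ?m p * rho = t \<cdot>\<^sub>m rho" if "pauli_eigen N psi (scatter xs p) t" for p t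
  proof (rule eq_matI)
    fix k l assume "k < dim_row (t \<cdot>\<^sub>m rho)" "l < dim_col (t \<cdot>\<^sub>m rho)"
    then have kl: "k < 2 ^ ?m" "l < 2 ^ ?m" by (auto simp: rho)
    show "(pauli_mat ?m p * rho) $$ (k, l) = (t \<cdot>\<^sub>m rho) $$ (k, l)"
      using that kl by (simp add: mult_rho pauli_eigen_def join_less)
        (simp add: rho sum_distrib_left mult.assoc)
  qed (auto simp: rho)
  have w_expect: "w p = pauli_expect N psi (scatter xs p)" for p
    by (simp add: w_def mtrace_def mult_rho pauli_expect_def sum_join mult.commute)
  have w_sq: "w p * w p = 1" and w_eig: "pauli_mat ?m p * rho = w p \<cdot>\<^sub>m rho" if "p \<in> G" for p
  proof -
    from that obtain t where p: "pauli_string ?m p" and "pauli_eigen N psi (scatter xs p) t"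
      by (auto simp: G_def)
    note t = eig[OF this(2)]
    have "w p = t" using tr carr by (simp add: w_def t mtrace_smult)
    then show *: "pauli_mat ?m p * rho = w p \<cdot>\<^sub>m rho" using t by simp
    \<comment> \<open>P is an involution, so applying it twice to \<open>rho\<close> multiplies by
      \<open>w p * w p\<close>; comparing traces shows that this factor is 1.\<close>
    have "rho = pauli_mat ?m p * (pauli_mat ?m p * rho)"
      using carr by (simp add: pauli_square[OF p] assoc_mult_mat[symmetric, of _ "2 ^ ?m" "2 ^ ?m" _ "2 ^ ?m" _ "2 ^ ?m"])
    also have "\<dots> = (w p * w p) \<cdot>\<^sub>m rho"
      using carr * by (simp add: mult_smult_distrib[of _ "2 ^ ?m" "2 ^ ?m" _ "2 ^ ?m"])
    finally have "mtrace rho = w p * w p * mtrace rho"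
      using carr by (metis mtrace_smult)
    then show "w p * w p = 1" using tr by simp
  qed
  have w_0: "w p = 0" if "pauli_string ?m p" "p \<notin> G" for p
  proof -
    have "pauli_string N (scatter xs p)" using bij_betwE[OF bij_scatter] that by blast
    then show ?thesis using dich that by (auto simp: pauli_dichotomy_def G_def w_expect)
  qed
  \<comment> \<open>Inversion formula: completeness collapses the double sum in the trace to the
    single entry \<open>rho $$ (k, l)\<close>.\<close>
  have expand: "rho $$ (k, l) = (\<Sum>p | pauli_string ?m p. w p * pauli_mat ?m p $$ (k, l)) / 2 ^ ?m"
    if "k < 2 ^ ?m" "l < 2 ^ ?m" for k l
  proof -
    have "(\<Sum>p | pauli_string ?m p. w p * pauli_mat ?m p $$ (k, l))
       = (\<Sum>p | pauli_string ?m p. \<Sum>a<2 ^ ?m. \<Sum>b<2 ^ ?m.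
            rho $$ (b, a) * (pauli_mat ?m p $$ (a, b) * pauli_mat ?m p $$ (k, l)))"
      using carr by (intro sum.cong refl)
        (simp add: w_def mtrace_def scalar_prod_def lessThan_atLeast0 sum_distrib_right sum_distrib_left mult_ac)
    also have "\<dots> = (\<Sum>a<2 ^ ?m. \<Sum>b<2 ^ ?m. \<Sum>p | pauli_string ?m p.
            rho $$ (b, a) * (pauli_mat ?m p $$ (a, b) * pauli_mat ?m p $$ (k, l)))"
      by (subst sum.swap, rule sum.cong[OF refl], rule sum.swap)
    also have "\<dots> = (\<Sum>a<2 ^ ?m. \<Sum>b<2 ^ ?m. if a = l then if b = k then rho $$ (b, a) * 2 ^ ?m else 0 else 0)"
      using that by (intro sum.cong refl) (simp add: sum_distrib_left[symmetric] pauli_completeness)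
    also have "\<dots> = rho $$ (k, l) * 2 ^ ?m"
    proof -
      have "(\<Sum>b<2 ^ ?m. if a = l then if b = k then rho $$ (b, a) * 2 ^ ?m else 0 else 0)
          = (if a = l then rho $$ (k, l) * 2 ^ ?m else 0)" for a
        using that by simp
      then show ?thesis using that by simp
    qed
    finally show ?thesis by simp
  qed
  have fin: "finite G" by (rule finite_subset[OF _ finite_pauli_strings[of ?m]]) (auto simp: G_def)
  have sq: "rho * rho = complex_of_real (real (card G) / 2 ^ ?m) \<cdot>\<^sub>m rho"
  proof (rule eq_matI)
    fix k l assume "k < dim_row (complex_of_real (real (card G) / 2 ^ ?m) \<cdot>\<^sub>m rho)"
      "l < dim_col (complex_of_real (real (card G) / 2 ^ ?m) \<cdot>\<^sub>m rho)"
    then have kl: "k < 2 ^ ?m" "l < 2 ^ ?m" by (auto simp: rho)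
    have "(rho * rho) $$ (k, l) = (\<Sum>x<2 ^ ?m. rho $$ (k, x) * rho $$ (x, l))"
      using carr kl by (simp add: scalar_prod_def lessThan_atLeast0)
    \<comment> \<open>Only the left factor is expanded; the right one stays intact, so that each P
      meets \<open>rho\<close> and the eigenvalue equation can be used.\<close>
    also have "\<dots> = (\<Sum>x<2 ^ ?m. \<Sum>p | pauli_string ?m p. w p * (pauli_mat ?m p $$ (k, x) * rho $$ (x, l)) / 2 ^ ?m)"
      using kl by (intro sum.cong refl) (simp add: expand[of k] sum_distrib_right sum_divide_distrib mult.assoc)
    also have "\<dots> = (\<Sum>p | pauli_string ?m p. w p * (pauli_mat ?m p * rho) $$ (k, l) / 2 ^ ?m)"
      using carr kl by (subst sum.swap)
        (simp add: scalar_prod_def lessThan_atLeast0 sum_distrib_left sum_divide_distrib)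
    also have "\<dots> = (\<Sum>p\<in>G. w p * (pauli_mat ?m p * rho) $$ (k, l) / 2 ^ ?m)"
      by (rule sum.mono_neutral_right) (auto simp: w_0, auto simp: G_def)
    also have "\<dots> = (\<Sum>p\<in>G. rho $$ (k, l) / 2 ^ ?m)"
    proof (intro sum.cong refl)
      fix p assume p: "p \<in> G"
      show "w p * (pauli_mat ?m p * rho) $$ (k, l) / 2 ^ ?m = rho $$ (k, l) / 2 ^ ?m"
        unfolding w_eig[OF p] using kl carr w_sq[OF p] by (simp add: mult.assoc[symmetric])
    qed
    finally show "(rho * rho) $$ (k, l) = (complex_of_real (real (card G) / 2 ^ ?m) \<cdot>\<^sub>m rho) $$ (k, l)"
      using kl carr by simp
  qed (auto simp: rho)
  have "scatter xs ` {p. pauli_string ?m p} = {p. pauli_string N p \<and> supported_on p (set xs)}"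
    using bij_scatter by (simp add: bij_betw_def)
  then have image: "pauli_string N p \<and> supported_on p (set xs)
      \<longleftrightarrow> (\<exists>q. pauli_string ?m q \<and> p = scatter xs q)" for p
    by (auto simp: set_eq_iff image_iff)
  have "scatter xs ` G = stabilizer_labels N psi (set xs)"
    unfolding G_def stabilizer_labels_def conj_assoc[symmetric] image by auto
  moreover have "inj_on (scatter xs) G"
    using bij_scatter by (auto simp: bij_betw_def G_def intro: inj_on_subset)
  ultimately have "bij_betw (scatter xs) G (stabilizer_labels N psi (set xs))"
    by (simp add: bij_betw_def)
  then have card: "card (stabilizer_labels N psi (set xs)) = card G"
    by (simp add: bij_betw_same_card)
  \<comment> \<open>The identity string is always a stabilizer, so \<open>card G\<close> is positive
    and its logarithm is meaningful.\<close>
  have "scatter xs (\<lambda>_. 0) = (\<lambda>_. 0)" by (simp add: scatter_def fun_eq_iff)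
  then have "pauli_eigen N psi (scatter xs (\<lambda>_. 0)) 1"
    by (auto simp: pauli_eigen_def pauli_apply_def pauli_mat_zero if_distrib[of "\<lambda>x. x * _"] cong: if_cong)
  then have "(\<lambda>_. 0) \<in> G" by (auto simp: G_def)
  then have pos: "card G > 0" using fin card_gt_0_iff by blast
  have "vn_entropy rho = - log 2 (real (card G) / 2 ^ ?m)"
    using vn_entropy_scaled_projector[OF carr sq tr] pos by simp
  also have "\<dots> = real ?m - log 2 (real (card G))"
    using pos by (simp add: log_divide log_nat_power)
  finally show ?thesis using card by simp
qed

lemma entropy_reduced_dm:
  assumes "(\<Sum>i<2 ^ N. psi i * cnj (psi i)) = 1" "pauli_dichotomy N psi" "X \<subseteq> {..<N}"
  shows "vn_entropy (reduced_dm N psi X)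
    = real (card X) - log 2 (real (card (stabilizer_labels N psi X)))"
proof -
  have fin: "finite X" using assms(3) finite_subset by blast
  interpret bipartition N "sorted_list_of_set X" "sorted_list_of_set ({0..<N} - X)"
    using assms(3) fin by unfold_locales auto
  show ?thesis
    using entropy_partial_trace[OF assms(1,2) refl] fin
    by (simp add: reduced_dm_def Let_def join_def)
qed

section \<open>Independence in elementary abelian 2-groups\<close>

locale boolean_group = comm_monoid_set +
  assumes self_cancel [simp]: "x \<^bold>* x = \<^bold>1"
begin

lemma left_self_cancel [simp]: "x \<^bold>* (x \<^bold>* y) = y"
  by (simp add: assoc[symmetric])

text \<open>Every element is its own inverse, so closure under inverses is implied.\<close>

definition is_subgroup :: "'a set \<Rightarrow> bool" where
  "is_subgroup T \<longleftrightarrow> \<^bold>1 \<in> T \<and> (\<forall>x\<in>T. \<forall>y\<in>T. x \<^bold>* y \<in> T)"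

text \<open>Linear independence over the field with two elements in the quotient by
  \<open>T\<close>: exponents are 0 or 1, so a linear combination is a product over a
  subset.\<close>

definition independent_mod :: "'a set \<Rightarrow> 'a set \<Rightarrow> bool" where
  "independent_mod T S \<longleftrightarrow> (\<forall>W. finite W \<longrightarrow> W \<subseteq> S \<longrightarrow> W \<noteq> {} \<longrightarrow> F (\<lambda>x. x) W \<notin> T)"

text \<open>The common elements occur twice and cancel, so products over sets behave like sums of
  indicator vectors modulo 2.\<close>

lemma F_sym_diff:
  assumes "finite U" "finite W"
  shows "F (\<lambda>x. x) U \<^bold>* F (\<lambda>x. x) W = F (\<lambda>x. x) ((U - W) \<union> (W - U))"
proof -
  have split: "F (\<lambda>x. x) X = F (\<lambda>x. x) (X - Y) \<^bold>* F (\<lambda>x. x) (X \<inter> Y)" if "finite X" for X Y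
  proof -
    have "(X - Y) \<union> (X \<inter> Y) = X" by blast
    then show ?thesis using that union_disjoint[of "X - Y" "X \<inter> Y" "\<lambda>x. x"] by auto
  qed
  have "F (\<lambda>x. x) U = F (\<lambda>x. x) (U - W) \<^bold>* F (\<lambda>x. x) (U \<inter> W)" "F (\<lambda>x. x) W = F (\<lambda>x. x) (W - U) \<^bold>* F (\<lambda>x. x) (U \<inter> W)"
    using split[of U W] split[of W U] assms by (simp_all only: Int_commute)
  then have "F (\<lambda>x. x) U \<^bold>* F (\<lambda>x. x) W = F (\<lambda>x. x) (U - W) \<^bold>* F (\<lambda>x. x) (W - U)"
    by (simp add: ac_simps)
  also have "\<dots> = F (\<lambda>x. x) ((U - W) \<union> (W - U))"
    using assms by (intro union_disjoint[symmetric]) auto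
  finally show ?thesis .
qed

lemma F_closed: "finite U \<Longrightarrow> is_subgroup V \<Longrightarrow> U \<subseteq> V \<Longrightarrow> F (\<lambda>x. x) U \<in> V"
  by (induction U rule: finite_induct) (auto simp: is_subgroup_def)

text \<open>If two representations agree, the product over the symmetric difference of
  \<open>U\<close> and \<open>W\<close> lies in \<open>T\<close>; independence makes that difference
  empty, and the \<open>T\<close> parts then cancel.\<close>

lemma inj_on_independent:
  assumes T: "is_subgroup T" and S: "finite S" "independent_mod T S"
  shows "inj_on (\<lambda>(U, t). F (\<lambda>x. x) U \<^bold>* t) (Pow S \<times> T)"
proof (rule inj_onI, clarify)
  fix U t W u
  assume U: "U \<subseteq> S" and W: "W \<subseteq> S" and tu: "t \<in> T" "u \<in> T" and eq: "F (\<lambda>x. x) U \<^bold>* t = F (\<lambda>x. x) W \<^bold>* u"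
  have fin: "finite U" "finite W" using U W S finite_subset by auto
  have "F (\<lambda>x. x) U \<^bold>* F (\<lambda>x. x) W = F (\<lambda>x. x) U \<^bold>* (F (\<lambda>x. x) W \<^bold>* u) \<^bold>* u" by (simp add: ac_simps)
  also have "\<dots> = t \<^bold>* u" unfolding eq[symmetric] by (simp add: ac_simps)
  finally have "F (\<lambda>x. x) ((U - W) \<union> (W - U)) \<in> T"
    using tu T F_sym_diff[OF fin] by (simp add: is_subgroup_def)
  moreover have "finite ((U - W) \<union> (W - U))" "(U - W) \<union> (W - U) \<subseteq> S" using fin U W by auto
  ultimately have "(U - W) \<union> (W - U) = {}"
    using S(2) unfolding independent_mod_def by metis
  then have "U = W" by blast
  then show "U = W \<and> t = u" using eq left_self_cancel by metis
qed

text \<open>An independent set of maximal size is a basis modulo \<open>T\<close>: each element of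
  \<open>V\<close> is a product over a unique subset times a unique element of \<open>T\<close>.
  Counting these pairs gives the formula.\<close>

lemma Max_independent:
  assumes fin: "finite V" and V: "is_subgroup V" and T: "is_subgroup T" "T \<subseteq> V"
  shows "2 ^ Max {card S | S. S \<subseteq> V \<and> independent_mod T S} * card T = card V"
proof -
  let ?A = "{card S | S. S \<subseteq> V \<and> independent_mod T S}"
  \<comment> \<open>\<open>Max\<close> is attained because the set of sizes is finite and contains
    that of the empty set.\<close>
  have "?A \<subseteq> card ` Pow V" by auto
  then have "finite ?A" using fin finite_subset by blast
  moreover have "independent_mod T {}" by (simp add: independent_mod_def)
  then have "?A \<noteq> {}" by blast
  ultimately have "Max ?A \<in> ?A" by (rule Max_in)
  then obtain S where S: "S \<subseteq> V" "independent_mod T S" and card: "card S = Max ?A" by auto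
  have finS: "finite S" using S fin finite_subset by blast
  have maximal: "\<not> independent_mod T (insert v S)" if "v \<in> V" "v \<notin> S" for v
  proof
    assume "independent_mod T (insert v S)"
    then have "card (insert v S) \<in> ?A" using that S by blast
    then have "card (insert v S) \<le> card S" using \<open>finite ?A\<close> card by simp
    then show False using that finS by simp
  qed
  have "(\<lambda>(U, t). F (\<lambda>x. x) U \<^bold>* t) ` (Pow S \<times> T) = V"
  proof (intro equalityI subsetI)
    fix v assume "v \<in> (\<lambda>(U, t). F (\<lambda>x. x) U \<^bold>* t) ` (Pow S \<times> T)"
    then obtain U t where U: "U \<subseteq> S" "t \<in> T" "v = F (\<lambda>x. x) U \<^bold>* t" by auto
    then have "F (\<lambda>x. x) U \<in> V" using S V finS finite_subset by (intro F_closed) auto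
    then show "v \<in> V" using U T V by (auto simp: is_subgroup_def)
  next
    fix v assume v: "v \<in> V"
    have "\<exists>U t. U \<subseteq> S \<and> t \<in> T \<and> v = F (\<lambda>x. x) U \<^bold>* t"
    proof (cases "v \<in> S")
      case True
      then show ?thesis using T by (intro exI[of _ "{v}"] exI[of _ "\<^bold>1"]) (auto simp: is_subgroup_def)
    next
      case False
      \<comment> \<open>Adding \<open>v\<close> destroys independence, so some product lies in
        \<open>T\<close>. It must involve \<open>v\<close>, as \<open>S\<close> itself is
        independent, and the relation can be solved for \<open>v\<close>.\<close>
      then obtain W where W: "finite W" "W \<subseteq> insert v S" "W \<noteq> {}" "F (\<lambda>x. x) W \<in> T"
        using maximal[OF v] by (auto simp: independent_mod_def)
      have "v \<in> W" using W S by (auto simp: independent_mod_def)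
      then have "F (\<lambda>x. x) W = v \<^bold>* F (\<lambda>x. x) (W - {v})" using W by (simp add: remove)
      then have "v = F (\<lambda>x. x) (W - {v}) \<^bold>* F (\<lambda>x. x) W" by (simp add: ac_simps)
      then show ?thesis using W by (intro exI[of _ "W - {v}"] exI[of _ "F (\<lambda>x. x) W"]) auto
    qed
    then show "v \<in> (\<lambda>(U, t). F (\<lambda>x. x) U \<^bold>* t) ` (Pow S \<times> T)" by force
  qed
  then have "card V = card (Pow S \<times> T)"
    using card_image[OF inj_on_independent[OF T(1) finS S(2)]] by simp
  then show ?thesis using finS card by (simp add: card_cartesian_product card_Pow)
qed

end

section \<open>Independence of logical operators as independence in the Pauli group modulo
  phases\<close>

interpretation pauli_group: boolean_group pxor "\<lambda>_. 0"
  by unfold_locales (auto simp: pxor_ac)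

lemma pauli_string_F:
  assumes "finite W" "\<And>p. p \<in> W \<Longrightarrow> pauli_string n p"
  shows "pauli_string n (pauli_group.F (\<lambda>x. x) W)"
  using assms by (induction W rule: finite_induct) (auto intro!: pauli_string_pxor)

text \<open>Each multiplication contributes only a nonzero phase, so the ordered matrix product
  depends on the order of the list only through a scalar.\<close>

lemma foldr_pauli_mat:
  assumes "distinct xs" "\<And>p. p \<in> set xs \<Longrightarrow> pauli_string n p"
  shows "\<exists>c. c \<noteq> 0 \<and> foldr (\<lambda>p M. pauli_mat n p * M) xs (1\<^sub>m (2 ^ n))
    = c \<cdot>\<^sub>m pauli_mat n (pauli_group.F (\<lambda>x. x) (set xs))"
  using assms
proof (induction xs)
  case Nil
  then show ?case by (intro exI[of _ 1]) (simp add: pauli_mat_zero)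
next
  case (Cons p xs)
  then obtain c where c: "c \<noteq> 0" "foldr (\<lambda>p M. pauli_mat n p * M) xs (1\<^sub>m (2 ^ n))
    = c \<cdot>\<^sub>m pauli_mat n (pauli_group.F (\<lambda>x. x) (set xs))" by auto
  have "pauli_string n (pauli_group.F (\<lambda>x. x) (set xs))" using Cons.prems by (intro pauli_string_F) auto
  then have "pauli_mat n p * (c \<cdot>\<^sub>m pauli_mat n (pauli_group.F (\<lambda>x. x) (set xs)))
      = (c * pauli_phase n p (pauli_group.F (\<lambda>x. x) (set xs))) \<cdot>\<^sub>m pauli_mat n (pauli_group.F (\<lambda>x. x) (set (p # xs)))"
    using Cons.prems by (simp add: mult_smult_distrib[of _ "2 ^ n" "2 ^ n" _ "2 ^ n"] pauli_mult)
  then show ?case using c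
    by (intro exI[of _ "c * pauli_phase n p (pauli_group.F (\<lambda>x. x) (set xs))"]) simp
qed

lemma trivial_on_code_smult:
  assumes "c \<noteq> 0" "M \<in> carrier_mat d d" "Pr \<in> carrier_mat d d"
  shows "trivial_on_code Pr (c \<cdot>\<^sub>m M) \<longleftrightarrow> trivial_on_code Pr M"
proof -
  have eq: "c \<cdot>\<^sub>m M * Pr = c \<cdot>\<^sub>m (M * Pr)"
    using assms(2,3) by (rule mult_smult_assoc_mat)
  show ?thesis
  proof
    assume "trivial_on_code Pr (c \<cdot>\<^sub>m M)"
    then obtain k where "c \<cdot>\<^sub>m (M * Pr) = k \<cdot>\<^sub>m Pr" unfolding trivial_on_code_def eq by blast
    then have "(1 / c) \<cdot>\<^sub>m (c \<cdot>\<^sub>m (M * Pr)) = (1 / c) \<cdot>\<^sub>m (k \<cdot>\<^sub>m Pr)" by simp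
    then show "trivial_on_code Pr M" using assms(1) by (auto simp: trivial_on_code_def)
  next
    assume "trivial_on_code Pr M"
    then show "trivial_on_code Pr (c \<cdot>\<^sub>m M)" unfolding trivial_on_code_def eq by auto
  qed
qed

text \<open>Nonzero scalars do not affect triviality, so a product along a distinct list may be
  replaced by the group product over its set.\<close>

lemma independent_logicals_iff:
  assumes S: "\<And>p. p \<in> S \<Longrightarrow> pauli_string n p" and Pr: "Pr \<in> carrier_mat (2 ^ n) (2 ^ n)"
  shows "independent_logicals n Pr S \<longleftrightarrow>
    pauli_group.independent_mod {p. trivial_on_code Pr (pauli_mat n p)} S"
proof -
  have key: "trivial_on_code Pr (foldr (\<lambda>p M. pauli_mat n p * M) xs (1\<^sub>m (2 ^ n)))
      \<longleftrightarrow> trivial_on_code Pr (pauli_mat n (pauli_group.F (\<lambda>x. x) (set xs)))"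
    if "distinct xs" "set xs \<subseteq> S" for xs
    using foldr_pauli_mat[of xs n] that S trivial_on_code_smult[OF _ pauli_mat_carrier Pr] by (metis subsetD)
  show ?thesis
  proof
    assume l: "independent_logicals n Pr S"
    show "pauli_group.independent_mod {p. trivial_on_code Pr (pauli_mat n p)} S"
      unfolding pauli_group.independent_mod_def
    proof (intro allI impI)
      fix W assume W: "finite W" "W \<subseteq> S" "W \<noteq> {}"
      then obtain xs where xs: "set xs = W" "distinct xs" using finite_distinct_list by blast
      then show "pauli_group.F (\<lambda>x. x) W \<notin> {p. trivial_on_code Pr (pauli_mat n p)}"
        using l key[of xs] W unfolding independent_logicals_def by auto
    qed
  next
    assume r: "pauli_group.independent_mod {p. trivial_on_code Pr (pauli_mat n p)} S"
    then show "independent_logicals n Pr S"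
      unfolding independent_logicals_def pauli_group.independent_mod_def using key by auto
  qed
qed

section \<open>The Pauli dichotomy is preserved by Clifford gates and Z measurements\<close>

lemma mult_carrier_square [simp]:
  "A \<in> carrier_mat n n \<Longrightarrow> B \<in> carrier_mat n n \<Longrightarrow> A * B \<in> carrier_mat n n"
  by (rule mult_carrier_mat)

lemma dagger_mult:
  assumes "A \<in> carrier_mat n m" "B \<in> carrier_mat m k"
  shows "dagger (A * B) = dagger B * dagger A"
  using assms by (intro eq_matI) (auto simp: dagger_def scalar_prod_def mult.commute intro!: sum.cong)

lemma mtrace_add:
  assumes "A \<in> carrier_mat n n" "B \<in> carrier_mat n n"
  shows "mtrace (A + B) = mtrace A + mtrace B"
  using assms by (auto simp: mtrace_def sum.distrib)

text \<open>In the Hilbert-Schmidt inner product, \<open>P C Q\<close> is parallel or orthogonal to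
  \<open>C\<close>. The zero matrix qualifies too, so nonvanishing need not be tracked along the
  circuit.\<close>

definition stabilizer_dichotomy :: "nat \<Rightarrow> complex mat \<Rightarrow> bool" where
  "stabilizer_dichotomy n C \<longleftrightarrow> (\<forall>p q. pauli_string n p \<longrightarrow> pauli_string n q \<longrightarrow>
     (\<exists>c. pauli_mat n p * (C * pauli_mat n q) = c \<cdot>\<^sub>m C)
     \<or> mtrace (dagger C * (pauli_mat n p * (C * pauli_mat n q))) = 0)"

text \<open>P Q is a phase times a single Pauli matrix, which is the identity or traceless.\<close>

lemma stabilizer_dichotomy_one: "stabilizer_dichotomy n (1\<^sub>m (2 ^ n))"
  unfolding stabilizer_dichotomy_def
proof (intro allI impI)
  fix p q assume pq: "pauli_string n p" "pauli_string n q"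
  let ?I = "1\<^sub>m (2 ^ n) :: complex mat"
  have d: "dagger ?I = ?I" by (auto simp: dagger_def)
  have e: "pauli_mat n p * (?I * pauli_mat n q) = pauli_phase n p q \<cdot>\<^sub>m pauli_mat n (pxor p q)"
    using pq by (simp add: pauli_mult)
  show "(\<exists>c. pauli_mat n p * (?I * pauli_mat n q) = c \<cdot>\<^sub>m ?I)
     \<or> mtrace (dagger ?I * (pauli_mat n p * (?I * pauli_mat n q))) = 0"
  proof (cases "pxor p q = (\<lambda>_. 0)")
    case True
    then show ?thesis unfolding e by (auto simp: pauli_mat_zero)
  next
    case False
    then show ?thesis unfolding e d using pq
      by (simp add: left_mult_one_mat[of _ "2 ^ n" "2 ^ n"] mtrace_smult[of _ "2 ^ n"] mtrace_pauli pauli_string_pxor)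
  qed
qed

text \<open>Moving P through \<open>E\<close> turns it into another Pauli up to a scalar, and
  \<open>E\<close> preserves Hilbert-Schmidt inner products, so \<open>E * C\<close> inherits the
  alternative that \<open>C\<close> has for the new Pauli.\<close>

lemma stabilizer_dichotomy_unitary:
  assumes C: "C \<in> carrier_mat (2 ^ n) (2 ^ n)" and E: "E \<in> carrier_mat (2 ^ n) (2 ^ n)"
    and unit: "dagger E * E = 1\<^sub>m (2 ^ n)"
    and conj: "\<And>p. pauli_string n p \<Longrightarrow>
      \<exists>q c. pauli_string n q \<and> pauli_mat n p * E = c \<cdot>\<^sub>m (E * pauli_mat n q)"
    and dich: "stabilizer_dichotomy n C"
  shows "stabilizer_dichotomy n (E * C)"
  unfolding stabilizer_dichotomy_def
proof (intro allI impI)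
  fix p q assume pq: "pauli_string n p" "pauli_string n q"
  let ?d = "2 ^ n :: nat" and ?P = "pauli_mat n"
  note assoc = assoc_mult_mat[of _ ?d ?d _ ?d _ ?d]
  note smult = mult_smult_distrib[of _ ?d ?d _ ?d] mult_smult_assoc_mat[of _ ?d ?d _ ?d]
  obtain p' c where p': "pauli_string n p'" "?P p * E = c \<cdot>\<^sub>m (E * ?P p')"
    using conj[OF pq(1)] by blast
  let ?M = "?P p' * (C * ?P q)"
  have M: "?M \<in> carrier_mat ?d ?d" using C by auto
  have step: "?P p * (E * C * ?P q) = c \<cdot>\<^sub>m (E * ?M)"
  proof -
    have "?P p * (E * C * ?P q) = (?P p * E) * (C * ?P q)"
      using C E by (simp add: assoc)
    also have "\<dots> = c \<cdot>\<^sub>m (E * ?M)"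
      unfolding p' using C E by (simp add: assoc smult)
    finally show ?thesis .
  qed
  consider t where "?M = t \<cdot>\<^sub>m C" | "mtrace (dagger C * ?M) = 0"
    using dich p'(1) pq(2) unfolding stabilizer_dichotomy_def by blast
  then show "(\<exists>c. ?P p * (E * C * ?P q) = c \<cdot>\<^sub>m (E * C))
     \<or> mtrace (dagger (E * C) * (?P p * (E * C * ?P q))) = 0"
  proof cases
    case 1
    show ?thesis unfolding step unfolding 1 using C E by (auto simp: smult)
  next
    case 2
    have "dagger (E * C) * (c \<cdot>\<^sub>m (E * ?M)) = c \<cdot>\<^sub>m (dagger C * (dagger E * (E * ?M)))"
      using C E M by (simp add: dagger_mult[of _ ?d ?d _ ?d] assoc smult)
    also have "dagger E * (E * ?M) = dagger E * E * ?M"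
      using C E M by (simp add: assoc)
    also have "\<dots> = ?M" unfolding unit using M by simp
    finally have "mtrace (dagger (E * C) * (?P p * (E * C * ?P q))) = c * mtrace (dagger C * ?M)"
      unfolding step using C M by (simp add: mtrace_smult[of _ ?d])
    then show ?thesis using 2 by simp
  qed
qed

text \<open>If P anticommutes with Z, then \<open>G P G = 0\<close> and the overlap vanishes. If
  they commute, P and P Z act on \<open>G * C\<close> alike up to a scalar: either one of them fixes
  \<open>C\<close> and hence \<open>G * C\<close>, or both overlaps vanish and so does their
  combination.\<close>

lemma stabilizer_dichotomy_projector:
  assumes C: "C \<in> carrier_mat (2 ^ n) (2 ^ n)"
    and z: "pauli_string n z" and s: "s = 1 \<or> s = (-1 :: complex)"
    and G: "G = (1 / 2) \<cdot>\<^sub>m 1\<^sub>m (2 ^ n) + (s / 2) \<cdot>\<^sub>m pauli_mat n z"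
    and dich: "stabilizer_dichotomy n C"
  shows "stabilizer_dichotomy n (G * C)"
  unfolding stabilizer_dichotomy_def
proof (intro allI impI)
  fix p q assume pq: "pauli_string n p" "pauli_string n q"
  let ?d = "2 ^ n :: nat" and ?P = "pauli_mat n"
  let ?Z = "?P z"
  note assoc = assoc_mult_mat[of _ ?d ?d _ ?d _ ?d]
  note smult = mult_smult_distrib[of _ ?d ?d _ ?d] mult_smult_assoc_mat[of _ ?d ?d _ ?d]
  note distrib = add_mult_distrib_mat[of _ ?d ?d _ _ ?d] mult_add_distrib_mat[of _ ?d ?d _ ?d]
  have ss: "s * s = 1" using s by auto
  have Gc: "G \<in> carrier_mat ?d ?d" by (simp add: G)
  have GZ: "G * ?Z = s \<cdot>\<^sub>m G" and ZG: "?Z * G = s \<cdot>\<^sub>m G"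
    using ss z
    by (auto simp: G distrib smult pauli_square add_smult_distrib_left_mat[of _ ?d ?d]
        left_mult_one_mat[of _ ?d ?d] right_mult_one_mat[of _ ?d ?d] comm_add_mat[of _ ?d ?d])
  have GG: "G * G = G"
  proof -
    have "G * G = (1 / 2) \<cdot>\<^sub>m G + (s / 2) \<cdot>\<^sub>m (G * ?Z)"
      using Gc by (subst (2) G) (simp add: distrib smult right_mult_one_mat[of _ ?d ?d])
    also have "\<dots> = G" unfolding GZ using ss
      by (intro eq_matI) (auto simp: field_simps)
    finally show ?thesis .
  qed
  have Gd: "dagger G = G"
    using s dagger_pauli[of n z]
    by (intro eq_matI) (auto simp: G dagger_def mat_eq_iff)
  have assoc4: "?P p * (G * C * ?P q) = (?P p * G) * (C * ?P q)"
    using C Gc by (simp add: assoc)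
  have tr: "dagger (G * C) * (?P p * (G * C * ?P q)) = dagger C * ((G * (?P p * G)) * (C * ?P q))"
    using C Gc by (simp add: dagger_mult[of _ ?d ?d _ ?d] Gd assoc)
  obtain t where t: "t = 1 \<or> t = -1" "?P p * ?Z = t \<cdot>\<^sub>m (?Z * ?P p)"
    using pauli_commute[OF pq(1) z] by blast
  show "(\<exists>c. ?P p * (G * C * ?P q) = c \<cdot>\<^sub>m (G * C))
     \<or> mtrace (dagger (G * C) * (?P p * (G * C * ?P q))) = 0"
  proof (cases "t = 1")
    case False
    \<comment> \<open>Z is created from the right \<open>G\<close>, pulled through P at the cost of
      a sign, and absorbed by the left \<open>G\<close>; so \<open>G P G\<close> equals its own
      negative.\<close>
    have "G * (?P p * G) = s \<cdot>\<^sub>m (G * (?P p * (?Z * G)))"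
      unfolding ZG using Gc ss by (simp add: smult)
    also have "?P p * (?Z * G) = - 1 \<cdot>\<^sub>m (?Z * (?P p * G))"
      using t False Gc by (simp add: assoc[symmetric] smult)
    also have "G * (- 1 \<cdot>\<^sub>m (?Z * (?P p * G))) = - 1 \<cdot>\<^sub>m ((G * ?Z) * (?P p * G))"
      using Gc by (simp add: assoc smult)
    also have "s \<cdot>\<^sub>m \<dots> = - 1 \<cdot>\<^sub>m (G * (?P p * G))"
      unfolding GZ using Gc ss by (simp add: smult assoc)
    finally have "G * (?P p * G) = - 1 \<cdot>\<^sub>m (G * (?P p * G))" .
    then have *: "(G * (?P p * G)) $$ (i, j) = (- 1 \<cdot>\<^sub>m (G * (?P p * G))) $$ (i, j)" for i j by simp
    have "G * (?P p * G) = 0\<^sub>m ?d ?d"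
    proof (rule eq_matI)
      fix i j assume ij: "i < dim_row (0\<^sub>m ?d ?d :: complex mat)" "j < dim_col (0\<^sub>m ?d ?d :: complex mat)"
      have "(- 1 \<cdot>\<^sub>m (G * (?P p * G))) $$ (i, j) = - (G * (?P p * G)) $$ (i, j)"
        using ij Gc by (subst index_smult_mat) auto
      then show "(G * (?P p * G)) $$ (i, j) = 0\<^sub>m ?d ?d $$ (i, j)"
        using *[of i j] ij by simp
    qed (use Gc in auto)
    then have "dagger (G * C) * (?P p * (G * C * ?P q)) = 0\<^sub>m ?d ?d"
      unfolding tr using C right_mult_zero_mat[OF dagger_carrier[OF C]] by simp
    then show ?thesis by (simp add: mtrace_def)
  next
    case True
    then have comm: "?P p * ?Z = ?Z * ?P p" using t by simp
    let ?p' = "pxor p z"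
    have p': "pauli_string n ?p'" by (intro pauli_string_pxor pq z)
    have PZ: "?P p * ?Z = pauli_phase n p z \<cdot>\<^sub>m ?P ?p'" using pq z by (simp add: pauli_mult)
    have PG: "?P p * G = G * ?P p"
      using comm by (simp add: G distrib smult left_mult_one_mat[of _ ?d ?d] right_mult_one_mat[of _ ?d ?d])
    let ?M = "?P p * (C * ?P q)" and ?M' = "?P ?p' * (C * ?P q)"
    have M: "?M \<in> carrier_mat ?d ?d" "?M' \<in> carrier_mat ?d ?d" using C by auto
    have step: "?P p * (G * C * ?P q) = G * ?M"
      unfolding assoc4 PG using C Gc by (simp add: assoc)
    \<comment> \<open>Since \<open>G * Z = s G\<close>, replacing P by P Z behind \<open>G\<close>
      changes only a scalar.\<close>
    have step': "G * ?M = (s * pauli_phase n p z) \<cdot>\<^sub>m (G * ?M')"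
    proof -
      have "G * ?M = s \<cdot>\<^sub>m ((s \<cdot>\<^sub>m G) * ?M)"
        using Gc M ss by (simp add: smult)
      also have "(s \<cdot>\<^sub>m G) * ?M = G * ((?P p * ?Z) * (C * ?P q))"
        unfolding GZ[symmetric] comm using Gc C by (simp add: assoc)
      also have "\<dots> = pauli_phase n p z \<cdot>\<^sub>m (G * ?M')"
        unfolding PZ using Gc C by (simp add: smult assoc)
      finally show ?thesis by simp
    qed
    consider c where "?M = c \<cdot>\<^sub>m C" | c where "?M' = c \<cdot>\<^sub>m C"
      | "mtrace (dagger C * ?M) = 0" "mtrace (dagger C * ?M') = 0"
      using dich pq p' unfolding stabilizer_dichotomy_def by blast
    then show ?thesis
    proof cases
      case 1
      show ?thesis unfolding step unfolding 1 using C Gc by (auto simp: smult)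
    next
      case 2
      show ?thesis unfolding step unfolding step' unfolding 2 using C Gc by (auto simp: smult)
    next
      case 3
      \<comment> \<open>With P and \<open>G\<close> commuting, one copy of \<open>G\<close> remains;
        expanding it writes the overlap as a combination of the two vanishing ones.\<close>
      have "G * (?P p * G) = ?P p * G"
        unfolding PG using Gc by (simp add: assoc[symmetric] GG)
      also have "\<dots> = (1 / 2) \<cdot>\<^sub>m ?P p + (s / 2 * pauli_phase n p z) \<cdot>\<^sub>m ?P ?p'"
        by (simp add: G distrib smult right_mult_one_mat[of _ ?d ?d] PZ)
      finally have "dagger (G * C) * (?P p * (G * C * ?P q))
        = (1 / 2) \<cdot>\<^sub>m (dagger C * ?M) + (s / 2 * pauli_phase n p z) \<cdot>\<^sub>m (dagger C * ?M')"
        unfolding tr using C by (simp add: distrib smult)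
      then show ?thesis
        using 3 C by (simp add: mtrace_add[of _ ?d] mtrace_smult[of _ ?d])
    qed
  qed
qed

section \<open>Measurement projectors and two-qubit Clifford gates inside the register\<close>

lemma gate_mat_carrier [simp]: "gate_mat L g \<in> carrier_mat (2 ^ L) (2 ^ L)"
  by (auto simp: gate_mat_def split: gate.split)

lemma gate_mat_dim [simp]: "dim_row (gate_mat L g) = 2 ^ L" "dim_col (gate_mat L g) = 2 ^ L"
  by (rule carrier_matD[OF gate_mat_carrier])+

lemma gate_mat_ZProj:
  assumes "i < L"
  shows "gate_mat L (ZProj i b) = (1 / 2) \<cdot>\<^sub>m 1\<^sub>m (2 ^ L)
    + ((if b then 1 else -1) / 2) \<cdot>\<^sub>m pauli_mat L ((\<lambda>_. 0)(i := 3))"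
proof (rule eq_matI)
  let ?R = "(1 / 2) \<cdot>\<^sub>m 1\<^sub>m (2 ^ L) + ((if b then 1 else -1) / 2) \<cdot>\<^sub>m pauli_mat L ((\<lambda>_. 0)(i := 3))"
  fix r c assume "r < dim_row ?R" "c < dim_col ?R"
  then have rc: "r < 2 ^ L" "c < 2 ^ L" by auto
  have "pauli_mat L ((\<lambda>_. 0)(i := 3)) $$ (r, c)
      = (if r = c then (if qbit i r = 0 then 1 else -1) else 0)"
  proof (cases "r = c")
    case True
    have "pauli_mat L ((\<lambda>_. 0)(i := 3)) $$ (r, c)
        = (\<Prod>j<L. if j = i then (if qbit i r = 0 then 1 else -1) else 1)"
    proof -
      have "pauli_mat L ((\<lambda>_. 0)(i := 3)) $$ (r, c)
          = (\<Prod>j<L. pauli1 (((\<lambda>_. 0)(i := 3)) j) (qbit j r) (qbit j r))"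
        using rc True by (simp add: pauli_mat_def)
      also have "\<dots> = (\<Prod>j<L. if j = i then (if qbit i r = 0 then 1 else -1) else 1)"
        by (rule prod.cong) (auto simp: pauli1_def)
      finally show ?thesis .
    qed
    then show ?thesis using True assms by simp
  next
    case False
    then obtain j where "j < L" "qbit j r \<noteq> qbit j c" using qbit_eqI[OF rc] by blast
    then show ?thesis using rc False by (auto simp: pauli_mat_def pauli1_def intro!: bexI[of _ j])
  qed
  then show "gate_mat L (ZProj i b) $$ (r, c) = ?R $$ (r, c)"
    using rc by (auto simp: gate_mat_def)
qed (auto simp: gate_mat_def)

text \<open>The gate is \<open>U\<close> on the sites \<open>a\<close>, \<open>b\<close> tensored
  with the identity. A basis index is split into \<open>loc\<close>, its index in the 4x4 matrix,
  and the remaining bits, compared by \<open>agree\<close>; the sites may be far apart and in either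
  order.\<close>

locale two_sites =
  fixes L a b :: nat and U :: "complex mat"
  assumes ab: "a < L" "b < L" "a \<noteq> b" and U: "clifford2 U"
begin

abbreviation "E \<equiv> gate_mat L (Gate2 a b U)"

definition loc :: "nat \<Rightarrow> nat" where "loc r = qbit a r + 2 * qbit b r"

definition agree :: "nat \<Rightarrow> nat \<Rightarrow> bool" where
  "agree r c \<longleftrightarrow> (\<forall>j<L. j \<noteq> a \<longrightarrow> j \<noteq> b \<longrightarrow> qbit j r = qbit j c)"

definition rest :: "(nat \<Rightarrow> nat) \<Rightarrow> nat \<Rightarrow> nat \<Rightarrow> complex" where
  "rest p r c = (\<Prod>j\<in>{..<L} - {a, b}. pauli1 (p j) (qbit j r) (qbit j c))"

definition loc_string :: "(nat \<Rightarrow> nat) \<Rightarrow> nat \<Rightarrow> nat" where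
  "loc_string p = (\<lambda>_. 0)(0 := p a, 1 := p b)"

lemma U_carrier: "U \<in> carrier_mat 4 4"
  using U by (simp add: clifford2_def unitary_mat_def)

lemma loc_less: "loc r < 4"
  using qbit_cases[of a r] qbit_cases[of b r] by (auto simp: loc_def)

lemma qbit_loc: "qbit 0 (loc r) = qbit a r" "qbit (Suc 0) (loc r) = qbit b r"
  using qbit_cases[of a r] qbit_cases[of b r] by (auto simp: loc_def qbit_def[of 0] qbit_def[of "Suc 0"])

lemma E_entry: "r < 2 ^ L \<Longrightarrow> c < 2 ^ L \<Longrightarrow> E $$ (r, c) = (if agree r c then U $$ (loc r, loc c) else 0)"
  by (auto simp: gate_mat_def agree_def loc_def)

lemma E_entry': "r < 2 ^ L \<Longrightarrow> c < 2 ^ L \<Longrightarrow> E $$ (r, c) = (if agree c r then U $$ (loc r, loc c) else 0)"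
  by (subst E_entry) (auto simp: agree_def)

lemma agree_trans: "agree r m \<Longrightarrow> agree m c \<longleftrightarrow> agree r c" "agree r m \<Longrightarrow> agree c m \<longleftrightarrow> agree r c"
  by (auto simp: agree_def)

lemma rest_agree: "agree r m \<Longrightarrow> rest p m c = rest p r c" "agree c m \<Longrightarrow> rest p r m = rest p r c"
  by (auto simp: rest_def agree_def intro!: prod.cong)

lemma agree_loc_eq:
  assumes "r < 2 ^ L" "c < 2 ^ L" "agree r c" "loc r = loc c"
  shows "r = c"
proof (rule qbit_eqI[OF assms(1,2)])
  fix j assume "j < L"
  have "qbit a r = qbit a c" "qbit b r = qbit b c" using assms(4) qbit_loc by metis+
  then show "qbit j r = qbit j c" using assms(3) \<open>j < L\<close> by (auto simp: agree_def)
qed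

lemma bij_loc: "bij_betw loc {m. m < 2 ^ L \<and> agree r m} {..<4}"
proof (rule bij_betw_imageI)
  show "inj_on loc {m. m < 2 ^ L \<and> agree r m}"
    using agree_loc_eq agree_trans(1) by (intro inj_onI) blast
  show "loc ` {m. m < 2 ^ L \<and> agree r m} = {..<4}"
  proof (intro equalityI subsetI)
    fix x :: nat assume x: "x \<in> {..<4}"
    \<comment> \<open>The bits of \<open>r\<close> with those at \<open>a\<close> and
      \<open>b\<close> overwritten by the two bits of \<open>x\<close>.\<close>
    define m where "m = of_bits L (\<lambda>j. if j = a then qbit 0 x else if j = b then qbit 1 x else qbit j r)"
    have bits: "qbit j m = (if j = a then qbit 0 x else if j = b then qbit 1 x else qbit j r)" if "j < L" for j
      unfolding m_def using that by (subst qbit_of_bits) auto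
    have "x = qbit 0 x + 2 * qbit 1 x" using x by (auto simp: qbit_def less_4_cases)
    then have "loc m = x" using bits ab by (simp add: loc_def)
    moreover have "m < 2 ^ L" unfolding m_def by (rule of_bits_less) auto
    moreover have "agree r m" using bits by (auto simp: agree_def)
    ultimately show "x \<in> loc ` {m. m < 2 ^ L \<and> agree r m}" by blast
  qed (auto simp: loc_less)
qed

text \<open>The identity factor restricts a matrix product to the four basis states that share the
  remaining bits, one for each value of \<open>loc\<close>.\<close>

lemma sum_agree: "(\<Sum>m<2 ^ L. if agree r m then f (loc m) else 0) = (\<Sum>x<4. f x :: complex)"
proof -
  have "(\<Sum>m<2 ^ L. if agree r m then f (loc m) else 0) = (\<Sum>m\<in>{m. m < 2 ^ L \<and> agree r m}. f (loc m))"
    by (intro sum.mono_neutral_cong_right) auto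
  also have "\<dots> = (\<Sum>x<4. f x)"
    by (rule sum.reindex_bij_betw[OF bij_loc])
  finally show ?thesis .
qed

lemma pauli_mat_split:
  assumes "r < 2 ^ L" "c < 2 ^ L"
  shows "pauli_mat L p $$ (r, c) = pauli_mat 2 (loc_string p) $$ (loc r, loc c) * rest p r c"
proof -
  have "pauli_mat L p $$ (r, c) = (\<Prod>j\<in>{..<L}. pauli1 (p j) (qbit j r) (qbit j c))"
    using assms by (simp add: pauli_mat_def)
  also have "{..<L} = insert a (insert b ({..<L} - {a, b}))" using ab by auto
  also have "(\<Prod>j\<in>\<dots>. pauli1 (p j) (qbit j r) (qbit j c))
      = pauli1 (p a) (qbit a r) (qbit a c) * (pauli1 (p b) (qbit b r) (qbit b c) * rest p r c)"
    using ab by (simp add: rest_def)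
  also have "pauli1 (p a) (qbit a r) (qbit a c) * (pauli1 (p b) (qbit b r) (qbit b c) * rest p r c)
      = pauli_mat 2 (loc_string p) $$ (loc r, loc c) * rest p r c"
    using loc_less[of r] loc_less[of c]
    by (simp add: pauli_mat_def loc_string_def numeral_2_eq_2 qbit_loc)
  finally show ?thesis .
qed

text \<open>Within one block of four states the factor \<open>rest\<close> is constant; it comes out
  of the sum and leaves a 4x4 product.\<close>

lemma E_mult_pauli:
  assumes "r < 2 ^ L" "c < 2 ^ L"
  shows "(E * pauli_mat L p) $$ (r, c) = rest p r c * (U * pauli_mat 2 (loc_string p)) $$ (loc r, loc c)"
proof -
  have "(E * pauli_mat L p) $$ (r, c) = (\<Sum>m<2 ^ L. E $$ (r, m) * pauli_mat L p $$ (m, c))"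
    using assms by (simp add: scalar_prod_def lessThan_atLeast0)
  also have "\<dots> = (\<Sum>m<2 ^ L. if agree r m then rest p r c *
      (U $$ (loc r, loc m) * pauli_mat 2 (loc_string p) $$ (loc m, loc c)) else 0)"
    using assms by (intro sum.cong refl) (auto simp: E_entry pauli_mat_split rest_agree)
  also have "\<dots> = (\<Sum>x<4. rest p r c * (U $$ (loc r, x) * pauli_mat 2 (loc_string p) $$ (x, loc c)))"
    by (rule sum_agree)
  also have "\<dots> = rest p r c * (\<Sum>x<4. U $$ (loc r, x) * pauli_mat 2 (loc_string p) $$ (x, loc c))"
    by (rule sum_distrib_left[symmetric])
  finally show ?thesis
    using U_carrier loc_less by (simp add: scalar_prod_def lessThan_atLeast0)
qed

lemma pauli_mult_E:
  assumes "r < 2 ^ L" "c < 2 ^ L"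
  shows "(pauli_mat L p * E) $$ (r, c) = rest p r c * (pauli_mat 2 (loc_string p) * U) $$ (loc r, loc c)"
proof -
  have "(pauli_mat L p * E) $$ (r, c) = (\<Sum>m<2 ^ L. pauli_mat L p $$ (r, m) * E $$ (m, c))"
    using assms by (simp add: scalar_prod_def lessThan_atLeast0)
  also have "\<dots> = (\<Sum>m<2 ^ L. if agree c m then rest p r c *
      (pauli_mat 2 (loc_string p) $$ (loc r, loc m) * U $$ (loc m, loc c)) else 0)"
    using assms by (intro sum.cong refl) (auto simp: E_entry' pauli_mat_split rest_agree)
  also have "\<dots> = (\<Sum>x<4. rest p r c * (pauli_mat 2 (loc_string p) $$ (loc r, x) * U $$ (x, loc c)))"
    by (rule sum_agree)
  also have "\<dots> = rest p r c * (\<Sum>x<4. pauli_mat 2 (loc_string p) $$ (loc r, x) * U $$ (x, loc c))"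
    by (rule sum_distrib_left[symmetric])
  finally show ?thesis
    using U_carrier loc_less by (simp add: scalar_prod_def lessThan_atLeast0)
qed

lemma dagger_E_mult_E: "dagger E * E = 1\<^sub>m (2 ^ L)"
proof (rule eq_matI)
  fix r c assume "r < dim_row (1\<^sub>m (2 ^ L) :: complex mat)" "c < dim_col (1\<^sub>m (2 ^ L) :: complex mat)"
  then have rc: "r < 2 ^ L" "c < 2 ^ L" by auto
  have UU: "dagger U * U = 1\<^sub>m 4" using U by (simp add: clifford2_def unitary_mat_def)
  have "(dagger E * E) $$ (r, c) = (\<Sum>m<2 ^ L. cnj (E $$ (m, r)) * E $$ (m, c))"
    using rc by (simp add: scalar_prod_def lessThan_atLeast0 dagger_def)
  also have "\<dots> = (\<Sum>m<2 ^ L. if agree r m then (if agree r c then cnj (U $$ (loc m, loc r)) * U $$ (loc m, loc c) else 0) else 0)"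
    using rc by (intro sum.cong refl) (simp add: E_entry' agree_trans(2)[of r _ c])
  also have "\<dots> = (\<Sum>x<4. if agree r c then cnj (U $$ (x, loc r)) * U $$ (x, loc c) else 0)"
    by (rule sum_agree)
  also have "\<dots> = (if agree r c then (dagger U * U) $$ (loc r, loc c) else 0)"
    using U_carrier loc_less by (simp add: scalar_prod_def lessThan_atLeast0 dagger_def)
  also have "\<dots> = (if r = c then 1 else 0)"
    using agree_loc_eq[OF rc] loc_less by (auto simp: UU agree_def)
  finally show "(dagger E * E) $$ (r, c) = 1\<^sub>m (2 ^ L) $$ (r, c)" using rc by simp
qed (auto simp: gate_mat_def dagger_def)

text \<open>Conjugation by \<open>U\<close> is an injective, hence surjective, map on the finitely many Paulis modulo phase.\<close>

lemma clifford_pull: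
  assumes "pauli_string 2 q"
  shows "\<exists>p c. pauli_string 2 p \<and> pauli_mat 2 q * U = c \<cdot>\<^sub>m (U * pauli_mat 2 p)"
proof -
  note assoc = assoc_mult_mat[of _ 4 4 _ 4 _ 4]
  note smult = mult_smult_distrib[of _ 4 4 _ 4] mult_smult_assoc_mat[of _ 4 4 _ 4]
  have P: "pauli_mat 2 p \<in> carrier_mat 4 4" for p using pauli_mat_carrier[of 2 p] by simp
  note [simp] = U_carrier P dagger_carrier[OF U_carrier]
  have UU: "dagger U * U = 1\<^sub>m 4" using U by (simp add: clifford2_def unitary_mat_def)
  have "\<forall>p. \<exists>c q. pauli_string 2 p \<longrightarrow>
      c \<in> phases \<and> pauli_string 2 q \<and> U * pauli_mat 2 p * dagger U = c \<cdot>\<^sub>m pauli_mat 2 q"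
    using U by (auto simp: clifford2_def is_pauli_op_def)
  then obtain c f where cf: "\<And>p. pauli_string 2 p \<Longrightarrow>
      c p \<in> phases \<and> pauli_string 2 (f p) \<and> U * pauli_mat 2 p * dagger U = c p \<cdot>\<^sub>m pauli_mat 2 (f p)"
    by metis
  have push: "U * pauli_mat 2 p = c p \<cdot>\<^sub>m (pauli_mat 2 (f p) * U)" if "pauli_string 2 p" for p
  proof -
    have "U * pauli_mat 2 p = U * pauli_mat 2 p * dagger U * U"
      by (simp add: assoc UU right_mult_one_mat[of _ 4 4])
    then show ?thesis using cf[OF that] by (simp add: smult)
  qed
  have "inj_on f {p. pauli_string 2 p}"
  proof (rule inj_onI, clarify)
    fix p p' assume p: "pauli_string 2 p" "pauli_string 2 p'" and eq: "f p = f p'"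
    have nz: "c p' \<noteq> 0" using cf[OF p(2)] phases_nonzero by blast
    have "U * pauli_mat 2 p = (c p / c p') \<cdot>\<^sub>m (U * pauli_mat 2 p')"
      using nz by (simp add: push p eq)
    then have "dagger U * (U * pauli_mat 2 p) = dagger U * ((c p / c p') \<cdot>\<^sub>m (U * pauli_mat 2 p'))" by simp
    then have "pauli_mat 2 p = (c p / c p') \<cdot>\<^sub>m pauli_mat 2 p'"
      by (simp add: smult assoc[symmetric] UU left_mult_one_mat[of _ 4 4])
    then show "p = p'" by (rule pauli_mat_inj[OF p])
  qed
  moreover have "f ` {p. pauli_string 2 p} \<subseteq> {p. pauli_string 2 p}" using cf by auto
  ultimately have "f ` {p. pauli_string 2 p} = {p. pauli_string 2 p}"
    by (intro endo_inj_surj) auto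
  then have "q \<in> f ` {p. pauli_string 2 p}" using assms by simp
  then obtain p where p: "pauli_string 2 p" "f p = q" by auto
  have nz: "c p \<noteq> 0" using cf[OF p(1)] phases_nonzero by blast
  have "pauli_mat 2 q * U = (1 / c p) \<cdot>\<^sub>m (U * pauli_mat 2 p)"
    using nz by (simp add: push p)
  then show ?thesis using p by blast
qed

text \<open>Only the labels at \<open>a\<close> and \<open>b\<close> change. The other sites
  contribute the same factor \<open>rest\<close> on both sides, so the 4x4 relation lifts to the
  register.\<close>

lemma pauli_pull:
  assumes p: "pauli_string L p"
  shows "\<exists>q c. pauli_string L q \<and> pauli_mat L p * E = c \<cdot>\<^sub>m (E * pauli_mat L q)"
proof -
  have "pauli_string 2 (loc_string p)"
    using p ab by (auto simp: loc_string_def pauli_string_def)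
  then obtain q' c where q': "pauli_string 2 q'"
    and pull: "pauli_mat 2 (loc_string p) * U = c \<cdot>\<^sub>m (U * pauli_mat 2 q')"
    using clifford_pull by blast
  define q where "q = p(a := q' 0, b := q' 1)"
  have q: "pauli_string L q"
    using p q' ab by (auto simp: q_def pauli_string_def)
  have "loc_string q j = q' j" for j
    using q' ab by (auto simp: loc_string_def q_def pauli_string_def)
  then have loc: "loc_string q = q'" by auto
  have rest: "rest q r s = rest p r s" for r s
    by (auto simp: rest_def q_def intro!: prod.cong)
  have "pauli_mat L p * E = c \<cdot>\<^sub>m (E * pauli_mat L q)"
  proof (rule eq_matI)
    fix r s assume "r < dim_row (c \<cdot>\<^sub>m (E * pauli_mat L q))" "s < dim_col (c \<cdot>\<^sub>m (E * pauli_mat L q))"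
    then have rs: "r < 2 ^ L" "s < 2 ^ L" by (auto simp: gate_mat_def)
    have "(pauli_mat L p * E) $$ (r, s) = rest p r s * (c \<cdot>\<^sub>m (U * pauli_mat 2 q')) $$ (loc r, loc s)"
      using rs by (simp only: pauli_mult_E pull)
    also have "\<dots> = c * (rest q r s * (U * pauli_mat 2 (loc_string q)) $$ (loc r, loc s))"
      using loc_less U_carrier by (simp add: rest loc)
    also have "\<dots> = c * (E * pauli_mat L q) $$ (r, s)"
      using rs by (simp only: E_mult_pauli)
    finally show "(pauli_mat L p * E) $$ (r, s) = (c \<cdot>\<^sub>m (E * pauli_mat L q)) $$ (r, s)"
      using rs by (simp add: gate_mat_def)
  qed (auto simp: gate_mat_def)
  then show ?thesis using q by blast
qed

end

lemma stabilizer_dichotomy_gate: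
  assumes C: "C \<in> carrier_mat (2 ^ L) (2 ^ L)" and "stabilizer_dichotomy L C" and valid: "valid_gate L g"
  shows "stabilizer_dichotomy L (gate_mat L g * C)"
proof (cases g)
  case (Gate2 a b U)
  then interpret two_sites L a b U
    using valid by unfold_locales (auto simp: valid_gate_def)
  show ?thesis unfolding Gate2
    by (rule stabilizer_dichotomy_unitary[OF C gate_mat_carrier dagger_E_mult_E pauli_pull assms(2)])
next
  case (ZProj i b)
  then have "i < L" using valid by (simp add: valid_gate_def)
  moreover from this have "pauli_string L ((\<lambda>_. 0)(i := 3))" by (auto simp: pauli_string_def)
  ultimately show ?thesis unfolding ZProj using assms(2)
    by (intro stabilizer_dichotomy_projector[OF C _ _ gate_mat_ZProj]) auto
qed

lemma circuit_mat_invariants: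
  assumes "\<forall>g\<in>set gs. valid_gate L g"
  shows "circuit_mat L gs \<in> carrier_mat (2 ^ L) (2 ^ L) \<and> stabilizer_dichotomy L (circuit_mat L gs)"
  using assms
\<comment> \<open>The last gate of the list is the leftmost factor, hence the induction from the
  end.\<close>
proof (induction gs rule: rev_induct)
  case Nil
  then show ?case by (simp add: circuit_mat_def stabilizer_dichotomy_one)
next
  case (snoc g gs)
  then have "circuit_mat L (gs @ [g]) = gate_mat L g * circuit_mat L gs"
    by (simp add: circuit_mat_def)
  then show ?case
    using snoc by (simp add: stabilizer_dichotomy_gate)
qed

section \<open>Stabilizers of the Choi state\<close>

text \<open>The label of P tensor Q, with \<open>p\<close> on the system and \<open>q\<close> on the
  reference, matching the qubit layout of \<open>choi_state\<close>.\<close>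

definition pauli_pair :: "nat \<Rightarrow> (nat \<Rightarrow> nat) \<Rightarrow> (nat \<Rightarrow> nat) \<Rightarrow> nat \<Rightarrow> nat" where
  "pauli_pair L p q = (\<lambda>j. if j < L then p j else q (j - L))"

lemma pauli_pair_cases:
  assumes "pauli_string (2 * L) r"
  obtains p q where "pauli_string L p" "pauli_string L q" "r = pauli_pair L p q"
proof
  show "pauli_string L (\<lambda>j. if j < L then r j else 0)" "pauli_string L (\<lambda>j. if j < L then r (L + j) else 0)"
    using assms by (auto simp: pauli_string_def)
  show "r = pauli_pair L (\<lambda>j. if j < L then r j else 0) (\<lambda>j. if j < L then r (L + j) else 0)"
    using assms by (auto simp: pauli_pair_def pauli_string_def fun_eq_iff)
qed

lemma pauli_string_pair: "pauli_string L p \<Longrightarrow> pauli_string L q \<Longrightarrow> pauli_string (2 * L) (pauli_pair L p q)"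
  by (auto simp: pauli_string_def pauli_pair_def)

lemma pauli_pair_inject:
  assumes "pauli_string L p" "pauli_string L p'" "pauli_pair L p q = pauli_pair L p' q'"
  shows "p = p' \<and> q = q'"
proof -
  have eq: "pauli_pair L p q j = pauli_pair L p' q' j" for j using assms(3) by simp
  have "p j = p' j" for j
    using eq[of j] assms(1,2) by (cases "j < L") (auto simp: pauli_pair_def pauli_string_def)
  moreover have "q j = q' j" for j
    using eq[of "L + j"] by (simp add: pauli_pair_def)
  ultimately show ?thesis by auto
qed

lemma supported_on_pair:
  assumes "pauli_string L p" "pauli_string L q" "B \<subseteq> {0..<L}"
  shows "supported_on (pauli_pair L p q) ((\<lambda>a. L + a) ` A \<union> B) \<longleftrightarrow> supported_on q A \<and> supported_on p B"
proof
  assume s: "supported_on (pauli_pair L p q) ((\<lambda>a. L + a) ` A \<union> B)"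
  have "q j = 0" if "j \<notin> A" for j
  proof -
    have "L + j \<notin> (\<lambda>a. L + a) ` A \<union> B" using that assms(3) by auto
    then have "pauli_pair L p q (L + j) = 0" using s unfolding supported_on_def by blast
    then show ?thesis by (simp add: pauli_pair_def)
  qed
  moreover have "p j = 0" if "j \<notin> B" for j
  proof (cases "j < L")
    case True
    then have "j \<notin> (\<lambda>a. L + a) ` A \<union> B" using that by auto
    then have "pauli_pair L p q j = 0" using s unfolding supported_on_def by blast
    then show ?thesis using True by (simp add: pauli_pair_def)
  qed (use assms(1) in \<open>simp add: pauli_string_def\<close>)
  ultimately show "supported_on q A \<and> supported_on p B" by (simp add: supported_on_def)
next
  assume s: "supported_on q A \<and> supported_on p B"
  show "supported_on (pauli_pair L p q) ((\<lambda>a. L + a) ` A \<union> B)"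
    unfolding supported_on_def
  proof (intro allI impI)
    fix j assume j: "j \<notin> (\<lambda>a. L + a) ` A \<union> B"
    show "pauli_pair L p q j = 0"
    proof (cases "j < L")
      case False
      then have "j - L \<notin> A" using j by (metis UnCI image_eqI le_add_diff_inverse not_less)
      then show ?thesis using s False by (simp add: pauli_pair_def supported_on_def)
    qed (use s j in \<open>simp add: pauli_pair_def supported_on_def\<close>)
  qed
qed

lemma index_pair_less:
  assumes "r < 2 ^ L" "s < 2 ^ L"
  shows "r + 2 ^ L * s < (2::nat) ^ (2 * L)"
proof -
  have "s + 1 \<le> 2 ^ L" using assms by simp
  then have "2 ^ L * (s + 1) \<le> (2::nat) ^ L * 2 ^ L" by (rule mult_left_mono) simp
  then have "2 ^ L * s + 2 ^ L \<le> (2::nat) ^ (2 * L)" by (simp add: mult_2 power_add)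
  then show ?thesis using assms(1) by linarith
qed

lemma index_pair_cases:
  assumes "i < (2::nat) ^ (2 * L)"
  obtains r s where "r < 2 ^ L" "s < 2 ^ L" "i = r + 2 ^ L * s"
proof
  show "i mod 2 ^ L < 2 ^ L" by simp
  show "i div 2 ^ L < 2 ^ L" using assms by (simp add: less_mult_imp_div_less mult_2 power_add)
  show "i = i mod 2 ^ L + 2 ^ L * (i div 2 ^ L)" by simp
qed

lemma sum_index_pair:
  "(\<Sum>i<(2::nat) ^ (2 * L). f i) = (\<Sum>s<2 ^ L. \<Sum>r<2 ^ L. f (r + 2 ^ L * s))"
  using sum_lessThan_mult[of f "2 ^ L" "2 ^ L"] by (simp add: mult_2 power_add)

lemma pauli_mat_pair:
  assumes "r < 2 ^ L" "s < 2 ^ L" "r' < 2 ^ L" "s' < 2 ^ L"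
  shows "pauli_mat (2 * L) (pauli_pair L p q) $$ (r + 2 ^ L * s, r' + 2 ^ L * s')
    = pauli_mat L p $$ (r, r') * pauli_mat L q $$ (s, s')"
proof -
  have split: "(\<Prod>j<2 * L. f j) = (\<Prod>j<L. f j) * (\<Prod>j<L. f (L + j))" for f :: "nat \<Rightarrow> complex"
  proof -
    have "(\<Prod>j<L + L. f j) = (\<Prod>j<L. f j) * (\<Prod>j\<in>{L..<L + L}. f j)"
      by (simp add: lessThan_atLeast0 prod.atLeastLessThan_concat)
    also have "(\<Prod>j\<in>{L..<L + L}. f j) = (\<Prod>j<L. f (L + j))"
      using prod.shift_bounds_nat_ivl[of f 0 L L] by (simp add: lessThan_atLeast0 add.commute)
    finally show ?thesis by (simp add: mult_2)
  qed
  show ?thesis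
    using assms by (simp add: pauli_mat_def index_pair_less split pauli_pair_def qbit_add_mult)
qed

text \<open>The remaining argument uses only these properties of the circuit and no longer refers to
  its gates.\<close>

locale stabilizer_map =
  fixes L :: nat and C :: "complex mat"
  assumes C: "C \<in> carrier_mat (2 ^ L) (2 ^ L)"
    and nonzero: "C \<noteq> 0\<^sub>m (2 ^ L) (2 ^ L)"
    and dichotomy: "stabilizer_dichotomy L C"
begin

abbreviation "P \<equiv> pauli_mat L"

text \<open>As \<open>P p\<close> is an involution, this says that \<open>C * P q\<close> is a
  multiple of \<open>P p * C\<close>: the input operator \<open>q\<close> is transferred to the
  output operator \<open>p\<close> up to a scalar.\<close>

definition fixing :: "(nat \<Rightarrow> nat) \<Rightarrow> (nat \<Rightarrow> nat) \<Rightarrow> bool" where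
  "fixing p q \<longleftrightarrow> (\<exists>c. P p * (C * P q) = c \<cdot>\<^sub>m C)"

definition nrm :: real where
  "nrm = (\<Sum>r<2 ^ L. \<Sum>s<2 ^ L. (cmod (C $$ (r, s)))\<^sup>2)"

lemmas assoc = assoc_mult_mat[of _ "2 ^ L" "2 ^ L" _ "2 ^ L" _ "2 ^ L"]
lemmas smult = mult_smult_distrib[of _ "2 ^ L" "2 ^ L" _ "2 ^ L"] mult_smult_assoc_mat[of _ "2 ^ L" "2 ^ L" _ "2 ^ L"]

lemma nonzero_entry: obtains r s where "r < 2 ^ L" "s < 2 ^ L" "C $$ (r, s) \<noteq> 0"
proof -
  have "\<exists>r s. r < 2 ^ L \<and> s < 2 ^ L \<and> C $$ (r, s) \<noteq> 0"
  proof (rule ccontr)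
    assume "\<not> ?thesis"
    then have "C = 0\<^sub>m (2 ^ L) (2 ^ L)" using C by (intro eq_matI) auto
    then show False using nonzero by simp
  qed
  then show ?thesis using that by blast
qed

lemma nrm_pos: "nrm > 0"
proof -
  obtain r s where rs: "r < 2 ^ L" "s < 2 ^ L" "C $$ (r, s) \<noteq> 0" by (rule nonzero_entry)
  have "0 < (\<Sum>s<2 ^ L. (cmod (C $$ (r, s)))\<^sup>2)"
    using rs by (intro sum_pos2[of _ s]) auto
  then show ?thesis unfolding nrm_def
    using rs by (intro sum_pos2[of "{..<2 ^ L}" r "\<lambda>r. \<Sum>s<2 ^ L. (cmod (C $$ (r, s)))\<^sup>2"] sum_nonneg) simp_all
qed

lemma smult_C_inject: "c \<cdot>\<^sub>m C = d \<cdot>\<^sub>m C \<Longrightarrow> c = d"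
proof -
  assume eq: "c \<cdot>\<^sub>m C = d \<cdot>\<^sub>m C"
  obtain r s where rs: "r < 2 ^ L" "s < 2 ^ L" "C $$ (r, s) \<noteq> 0" by (rule nonzero_entry)
  have "(c \<cdot>\<^sub>m C) $$ (r, s) = (d \<cdot>\<^sub>m C) $$ (r, s)" using eq by simp
  then show "c = d" using rs C by simp
qed

lemma mtrace_dagger_mult:
  assumes "M \<in> carrier_mat (2 ^ L) (2 ^ L)"
  shows "mtrace (dagger C * M) = (\<Sum>s<2 ^ L. \<Sum>r<2 ^ L. cnj (C $$ (r, s)) * M $$ (r, s))"
  using assms C by (auto simp: mtrace_def dagger_def scalar_prod_def lessThan_atLeast0 intro!: sum.cong)

lemma mtrace_gram: "mtrace (dagger C * C) = complex_of_real nrm"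
  unfolding mtrace_dagger_mult[OF C] nrm_def
  by (subst sum.swap) (simp only: of_real_sum complex_norm_square mult.commute)

lemma choi_state_pair:
  "r < 2 ^ L \<Longrightarrow> choi_state L C (r + 2 ^ L * s) = C $$ (r, s) / complex_of_real (sqrt nrm)"
  by (simp add: choi_state_def nrm_def)

lemma choi_state_norm: "(\<Sum>i<2 ^ (2 * L). choi_state L C i * cnj (choi_state L C i)) = 1"
proof -
  have "(\<Sum>i<2 ^ (2 * L). choi_state L C i * cnj (choi_state L C i))
     = (\<Sum>s<2 ^ L. \<Sum>r<2 ^ L. cnj (C $$ (r, s)) * C $$ (r, s) / complex_of_real nrm)"
    unfolding sum_index_pair using nrm_pos
    by (intro sum.cong refl)
      (simp add: choi_state_pair of_real_mult[symmetric] mult.commute[of "C $$ _"] del: of_real_mult)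
  also have "\<dots> = mtrace (dagger C * C) / complex_of_real nrm"
    by (simp add: mtrace_dagger_mult[OF C] sum_divide_distrib)
  finally show ?thesis using nrm_pos by (simp add: mtrace_gram)
qed

text \<open>For the vectorization of a matrix, P tensor Q sends \<open>C\<close> to P C times the
  transpose of Q, and that transpose is Q up to the sign \<open>pauli_tsign\<close>.\<close>

lemma pauli_apply_pair:
  assumes "r < 2 ^ L" "s < 2 ^ L"
  shows "pauli_apply (2 * L) (pauli_pair L p q) (choi_state L C) (r + 2 ^ L * s)
    = pauli_tsign L q * (P p * (C * P q)) $$ (r, s) / complex_of_real (sqrt nrm)"
proof -
  have "pauli_apply (2 * L) (pauli_pair L p q) (choi_state L C) (r + 2 ^ L * s)
     = (\<Sum>s'<2 ^ L. \<Sum>r'<2 ^ L. P p $$ (r, r') * P q $$ (s, s') * (C $$ (r', s') / complex_of_real (sqrt nrm)))"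
    using assms by (simp add: pauli_apply_def sum_index_pair pauli_mat_pair choi_state_pair)
  also have "\<dots> = (\<Sum>s'<2 ^ L. \<Sum>r'<2 ^ L. pauli_tsign L q * (P p $$ (r, r') * (C $$ (r', s') * P q $$ (s', s))) / complex_of_real (sqrt nrm))"
    using assms by (intro sum.cong refl) (simp add: pauli_transpose[of s L _ q])
  also have "\<dots> = pauli_tsign L q * (\<Sum>r'<2 ^ L. P p $$ (r, r') * (\<Sum>s'<2 ^ L. C $$ (r', s') * P q $$ (s', s))) / complex_of_real (sqrt nrm)"
    by (subst sum.swap) (simp add: sum_distrib_left sum_divide_distrib)
  also have "(\<Sum>r'<2 ^ L. P p $$ (r, r') * (\<Sum>s'<2 ^ L. C $$ (r', s') * P q $$ (s', s))) = (P p * (C * P q)) $$ (r, s)"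
    using assms C by (simp add: scalar_prod_def lessThan_atLeast0)
  finally show ?thesis .
qed

lemma pauli_eigen_pair:
  "(\<exists>t. pauli_eigen (2 * L) (choi_state L C) (pauli_pair L p q) t) \<longleftrightarrow> fixing p q"
proof
  have nz: "complex_of_real (sqrt nrm) \<noteq> 0" using nrm_pos by simp
  {
    assume "\<exists>t. pauli_eigen (2 * L) (choi_state L C) (pauli_pair L p q) t"
    then obtain t where t: "pauli_eigen (2 * L) (choi_state L C) (pauli_pair L p q) t" by blast
    have "P p * (C * P q) = (t / pauli_tsign L q) \<cdot>\<^sub>m C"
    proof (rule eq_matI)
      fix r s assume "r < dim_row ((t / pauli_tsign L q) \<cdot>\<^sub>m C)" "s < dim_col ((t / pauli_tsign L q) \<cdot>\<^sub>m C)"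
      then have rs: "r < 2 ^ L" "s < 2 ^ L" using C by auto
      have "pauli_tsign L q * (P p * (C * P q)) $$ (r, s) / complex_of_real (sqrt nrm)
          = t * (C $$ (r, s) / complex_of_real (sqrt nrm))"
        using t index_pair_less[OF rs] rs
        by (simp only: pauli_eigen_def pauli_apply_pair[symmetric] choi_state_pair[symmetric])
      then have "pauli_tsign L q * (P p * (C * P q)) $$ (r, s) = t * C $$ (r, s)"
        using nz by (simp del: index_mult_mat)
      then have "(P p * (C * P q)) $$ (r, s) = t / pauli_tsign L q * C $$ (r, s)"
        using pauli_tsign_nonzero[of L q] by (simp add: field_simps del: index_mult_mat pauli_tsign_nonzero)
      then show "(P p * (C * P q)) $$ (r, s) = ((t / pauli_tsign L q) \<cdot>\<^sub>m C) $$ (r, s)"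
        using rs C by simp
    qed (use C in auto)
    then show "fixing p q" unfolding fixing_def by blast
  next
    assume "fixing p q"
    then obtain c where c: "P p * (C * P q) = c \<cdot>\<^sub>m C" unfolding fixing_def by blast
    have "pauli_eigen (2 * L) (choi_state L C) (pauli_pair L p q) (pauli_tsign L q * c)"
      unfolding pauli_eigen_def
    proof (intro allI impI)
      fix i assume "i < (2::nat) ^ (2 * L)"
      then obtain r s where rs: "r < 2 ^ L" "s < 2 ^ L" "i = r + 2 ^ L * s" by (rule index_pair_cases)
      then show "pauli_apply (2 * L) (pauli_pair L p q) (choi_state L C) i = pauli_tsign L q * c * choi_state L C i"
        using C by (simp add: pauli_apply_pair choi_state_pair c)
    qed
    then show "\<exists>t. pauli_eigen (2 * L) (choi_state L C) (pauli_pair L p q) t" by blast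
  }
qed

text \<open>The expectation of P tensor Q is a nonzero multiple of the overlap of \<open>C\<close>
  with \<open>P C Q\<close>, so the two dichotomies match.\<close>

lemma choi_state_dichotomy: "pauli_dichotomy (2 * L) (choi_state L C)"
  unfolding pauli_dichotomy_def
proof (intro allI impI)
  fix v assume "pauli_string (2 * L) v"
  then obtain p q where pq: "pauli_string L p" "pauli_string L q" and v: "v = pauli_pair L p q"
    by (rule pauli_pair_cases)
  let ?M = "P p * (C * P q)"
  have M: "?M \<in> carrier_mat (2 ^ L) (2 ^ L)" using C by simp
  have "pauli_expect (2 * L) (choi_state L C) v
      = (\<Sum>s<2 ^ L. \<Sum>r<2 ^ L. pauli_tsign L q / complex_of_real nrm * (cnj (C $$ (r, s)) * ?M $$ (r, s)))"
    unfolding pauli_expect_def sum_index_pair v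
    using nrm_pos
    by (intro sum.cong refl)
      (simp add: pauli_apply_pair choi_state_pair of_real_mult[symmetric] del: of_real_mult index_mult_mat)
  also have "\<dots> = pauli_tsign L q / complex_of_real nrm * mtrace (dagger C * ?M)"
    unfolding mtrace_dagger_mult[OF M] by (simp only: sum_distrib_left)
  finally have "pauli_expect (2 * L) (choi_state L C) v
      = pauli_tsign L q / complex_of_real nrm * mtrace (dagger C * ?M)" .
  moreover have "fixing p q \<or> mtrace (dagger C * ?M) = 0"
    using dichotomy pq unfolding stabilizer_dichotomy_def fixing_def by blast
  ultimately show "(\<exists>t. pauli_eigen (2 * L) (choi_state L C) v t) \<or> pauli_expect (2 * L) (choi_state L C) v = 0"
    unfolding v pauli_eigen_pair by auto
qed

text \<open>The input label comes first, opposite to the arguments of \<open>fixing\<close>, so that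
  the set is a dependent sum over transferred input operators.\<close>

definition stab :: "nat set \<Rightarrow> nat set \<Rightarrow> ((nat \<Rightarrow> nat) \<times> (nat \<Rightarrow> nat)) set" where
  "stab A B = {(q, p). pauli_string L q \<and> supported_on q A \<and> pauli_string L p \<and> supported_on p B \<and> fixing p q}"

lemma card_stabilizer_labels:
  assumes "B \<subseteq> {0..<L}"
  shows "card (stabilizer_labels (2 * L) (choi_state L C) ((\<lambda>a. L + a) ` A \<union> B)) = card (stab A B)"
proof -
  have "stabilizer_labels (2 * L) (choi_state L C) ((\<lambda>a. L + a) ` A \<union> B) = (\<lambda>(q, p). pauli_pair L p q) ` stab A B"
  proof (intro equalityI subsetI)
    fix v assume "v \<in> stabilizer_labels (2 * L) (choi_state L C) ((\<lambda>a. L + a) ` A \<union> B)"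
    then have v: "pauli_string (2 * L) v" "supported_on v ((\<lambda>a. L + a) ` A \<union> B)"
      "\<exists>t. pauli_eigen (2 * L) (choi_state L C) v t" by (auto simp: stabilizer_labels_def)
    from v(1) obtain p q where pq: "pauli_string L p" "pauli_string L q" "v = pauli_pair L p q"
      by (rule pauli_pair_cases)
    then have "(q, p) \<in> stab A B"
      using v supported_on_pair[OF pq(1,2) assms] pauli_eigen_pair by (simp add: stab_def)
    then show "v \<in> (\<lambda>(q, p). pauli_pair L p q) ` stab A B" using pq(3) by force
  next
    fix v assume "v \<in> (\<lambda>(q, p). pauli_pair L p q) ` stab A B"
    then obtain p q where "(q, p) \<in> stab A B" "v = pauli_pair L p q" by auto
    then show "v \<in> stabilizer_labels (2 * L) (choi_state L C) ((\<lambda>a. L + a) ` A \<union> B)"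
      using supported_on_pair[OF _ _ assms] pauli_eigen_pair
      by (simp add: stab_def stabilizer_labels_def pauli_string_pair)
  qed
  moreover have "inj_on (\<lambda>(q, p). pauli_pair L p q) (stab A B)"
    unfolding stab_def by (rule inj_onI) (auto dest!: pauli_pair_inject[rotated 2])
  ultimately show ?thesis by (simp add: card_image)
qed

lemma entropy_choi_state:
  assumes "A \<subseteq> {0..<L}" "B \<subseteq> {0..<L}"
  shows "vn_entropy (reduced_dm (2 * L) (choi_state L C) ((\<lambda>a. L + a) ` A \<union> B))
    = real (card A) + real (card B) - log 2 (real (card (stab A B)))"
proof -
  have fin: "finite A" "finite B" using assms finite_subset by blast+
  have "card ((\<lambda>a. L + a) ` A \<union> B) = card ((\<lambda>a. L + a) ` A) + card B"
    using fin assms by (intro card_Un_disjoint) auto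
  also have "card ((\<lambda>a. L + a) ` A) = card A" by (intro card_image) auto
  finally have card: "card ((\<lambda>a. L + a) ` A \<union> B) = card A + card B" .
  have "(\<lambda>a. L + a) ` A \<union> B \<subseteq> {..<2 * L}" using assms by auto
  from entropy_reduced_dm[OF choi_state_norm choi_state_dichotomy this]
  show ?thesis by (simp add: card card_stabilizer_labels[OF assms(2)])
qed

text \<open>A subsystem lying only in the reference or only in the system is the case where the
  other set is empty; the qubit counts of the three entropies then cancel.\<close>

lemma mutual_info_eq:
  assumes "A \<subseteq> {0..<L}" "B \<subseteq> {0..<L}"
  shows "mutual_info (2 * L) (choi_state L C) ((\<lambda>a. L + a) ` A) B
    = log 2 (real (card (stab A B))) - log 2 (real (card (stab A {}))) - log 2 (real (card (stab {} B)))"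
  using entropy_choi_state[OF assms] entropy_choi_state[OF assms(1), of "{}"]
    entropy_choi_state[of "{}", OF _ assms(2)]
  by (simp add: mutual_info_def)

section \<open>Transferable logical operators\<close>

text \<open>One relation is nested inside the other, which reverses the order on the right of
  \<open>C\<close>; the reordering costs only nonzero phases.\<close>

lemma fixing_pxor:
  assumes "pauli_string L p" "pauli_string L p'" "pauli_string L q" "pauli_string L q'"
    and "fixing p q" "fixing p' q'"
  shows "fixing (pxor p p') (pxor q q')"
proof -
  obtain c c' where c: "P p * (C * P q) = c \<cdot>\<^sub>m C" "P p' * (C * P q') = c' \<cdot>\<^sub>m C"
    using assms(5,6) unfolding fixing_def by blast
  have "(P p * P p') * (C * (P q' * P q)) = P p * ((P p' * (C * P q')) * P q)"
    using C by (simp add: assoc)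
  also have "\<dots> = (c' * c) \<cdot>\<^sub>m C"
    using C by (simp add: c smult)
  finally have "(pauli_phase L p p' * pauli_phase L q' q) \<cdot>\<^sub>m (P (pxor p p') * (C * P (pxor q q'))) = (c' * c) \<cdot>\<^sub>m C"
    using C assms by (simp add: pauli_mult smult pxor_ac(2)[of q' q] mult.commute[of "pauli_phase L q' q"])
  then have "(1 / (pauli_phase L p p' * pauli_phase L q' q)) \<cdot>\<^sub>m
      ((pauli_phase L p p' * pauli_phase L q' q) \<cdot>\<^sub>m (P (pxor p p') * (C * P (pxor q q'))))
      = (1 / (pauli_phase L p p' * pauli_phase L q' q)) \<cdot>\<^sub>m ((c' * c) \<cdot>\<^sub>m C)" by simp
  then show ?thesis unfolding fixing_def by auto
qed

lemma fixing_zero: "fixing (\<lambda>_. 0) (\<lambda>_. 0)"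
  unfolding fixing_def using C by (intro exI[of _ 1]) (simp add: pauli_mat_zero)

text \<open>Both Paulis are involutions, so using the relation twice returns \<open>C\<close> with
  factor \<open>c * c\<close>, and \<open>C\<close> is nonzero.\<close>

lemma fixing_sign:
  assumes p: "pauli_string L p" and q: "pauli_string L q" and fixing: "fixing p q"
  obtains c where "c = 1 \<or> c = -1" "C * P q = c \<cdot>\<^sub>m (P p * C)"
proof -
  obtain c where c: "P p * (C * P q) = c \<cdot>\<^sub>m C" using fixing unfolding fixing_def by blast
  have "C * P q = (P p * P p) * (C * P q)" using C p by (simp add: pauli_square)
  also have "\<dots> = P p * (P p * (C * P q))" using C by (simp add: assoc)
  also have "\<dots> = c \<cdot>\<^sub>m (P p * C)" unfolding c using C by (simp add: smult)
  finally have eq: "C * P q = c \<cdot>\<^sub>m (P p * C)" .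
  have "C = C * (P q * P q)" using C q by (simp add: pauli_square)
  also have "\<dots> = (C * P q) * P q" using C by (simp add: assoc)
  also have "\<dots> = (c \<cdot>\<^sub>m (P p * C)) * P q" by (simp only: eq)
  also have "\<dots> = c \<cdot>\<^sub>m (P p * (C * P q))" using C by (simp add: smult assoc)
  also have "\<dots> = (c * c) \<cdot>\<^sub>m C" unfolding c by simp
  finally have "1 \<cdot>\<^sub>m C = (c * c) \<cdot>\<^sub>m C" by simp
  then have "c * c = 1" using smult_C_inject by metis
  then have "c = 1 \<or> c = -1" by (simp add: square_eq_1_iff)
  then show ?thesis using eq that by blast
qed

lemma dagger_smult: "dagger (c \<cdot>\<^sub>m M) = cnj c \<cdot>\<^sub>m dagger M"
  by (intro eq_matI) (auto simp: dagger_def)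

text \<open>The adjoint of the hypothesis: Paulis are Hermitian and the sign is real.\<close>

lemma pauli_mult_dagger:
  assumes "c = 1 \<or> c = -1" "C * P q = c \<cdot>\<^sub>m (P p * C)"
  shows "P q * dagger C = c \<cdot>\<^sub>m (dagger C * P p)"
proof -
  have "P q * dagger C = dagger (C * P q)"
    using C by (simp add: dagger_mult[of _ "2 ^ L" "2 ^ L" _ "2 ^ L"] dagger_pauli)
  also have "\<dots> = cnj c \<cdot>\<^sub>m (dagger C * P p)"
    unfolding assms(2) using C by (simp add: dagger_smult dagger_mult[of _ "2 ^ L" "2 ^ L" _ "2 ^ L"] dagger_pauli)
  finally show ?thesis using assms(1) by auto
qed

definition transferred :: "nat set \<Rightarrow> nat set \<Rightarrow> (nat \<Rightarrow> nat) set" where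
  "transferred A B = {q. pauli_string L q \<and> supported_on q A
     \<and> (\<exists>p. pauli_string L p \<and> supported_on p B \<and> fixing p q)}"

text \<open>Multiplying the transfer equation by the output Pauli gives \<open>fixing\<close>.
  Conversely \<open>fixing\<close> gives a transfer equation with a sign; together with its adjoint
  it reduces both orders of each required commutation to the same product.\<close>

lemma transferable_iff: "transferable L C A B q \<longleftrightarrow> q \<in> transferred A B"
proof
  assume "transferable L C A B q"
  then obtain Ot where q: "pauli_string L q" "supported_on q A"
    and Ot: "pauli_op_supported_on L Ot B" "C * P q = Ot * C"
    by (auto simp: transferable_def)
  then obtain c p where p: "pauli_string L p" "supported_on p B" "Ot = c \<cdot>\<^sub>m P p"
    by (auto simp: pauli_op_supported_on_def)
  have "P p * (C * P q) = c \<cdot>\<^sub>m ((P p * P p) * C)"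
    unfolding Ot(2) p(3) using C by (simp add: smult assoc)
  then have "fixing p q" using C p(1) by (auto simp: fixing_def pauli_square)
  then show "q \<in> transferred A B" using p q by (auto simp: transferred_def)
next
  assume "q \<in> transferred A B"
  then obtain p where q: "pauli_string L q" "supported_on q A"
    and p: "pauli_string L p" "supported_on p B" "fixing p q" by (auto simp: transferred_def)
  obtain c where c: "c = 1 \<or> c = -1" "C * P q = c \<cdot>\<^sub>m (P p * C)"
    using fixing_sign[OF p(1) q(1) p(3)] by blast
  note d = pauli_mult_dagger[OF c]
  have "P q * (dagger C * C) = (P q * dagger C) * C" using C by (simp add: assoc)
  also have "\<dots> = dagger C * (C * P q)" unfolding d c(2) using C by (simp add: assoc smult)
  also have "\<dots> = dagger C * C * P q" using C by (simp add: assoc)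
  finally have l1: "logical_op (dagger C * C) (P q)" by (simp add: logical_op_def)
  have "c \<cdot>\<^sub>m P p * (C * dagger C) = (C * P q) * dagger C" unfolding c(2) using C by (simp add: assoc smult)
  also have "\<dots> = C * (P q * dagger C)" using C by (simp add: assoc)
  also have "\<dots> = C * dagger C * (c \<cdot>\<^sub>m P p)" unfolding d using C by (simp add: assoc smult)
  finally have l2: "logical_op (C * dagger C) (c \<cdot>\<^sub>m P p)" by (simp add: logical_op_def)
  have "pauli_op_supported_on L (c \<cdot>\<^sub>m P p) B"
    using c(1) p(1,2) by (auto simp: pauli_op_supported_on_def phases_def)
  moreover have "C * P q = c \<cdot>\<^sub>m P p * C" using c(2) C by (simp add: smult)
  ultimately show "transferable L C A B q"
    using q l1 l2 by (auto simp: transferable_def)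
qed

text \<open>If \<open>C * P q\<close> is a sign times \<open>C\<close>, the adjoint relation shows
  triviality. Conversely, if \<open>q\<close> acts as \<open>c\<close> on the input code without
  fixing \<open>C\<close>, the dichotomy makes the trace of \<open>dagger C * C * P q\<close>
  vanish; then \<open>c = 0\<close>, which is impossible for an invertible operator.\<close>

lemma trivial_on_code_iff:
  assumes q: "pauli_string L q"
  shows "trivial_on_code (dagger C * C) (P q) \<longleftrightarrow> fixing (\<lambda>_. 0) q"
proof
  assume "fixing (\<lambda>_. 0) q"
  then obtain c where c: "c = 1 \<or> c = -1" "C * P q = c \<cdot>\<^sub>m (P (\<lambda>_. 0) * C)"
    using fixing_sign q pauli_string_zero by blast
  have "P q * (dagger C * C) = (P q * dagger C) * C" using C by (simp add: assoc)
  also have "\<dots> = c \<cdot>\<^sub>m (dagger C * C)"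
    unfolding pauli_mult_dagger[OF c] using C
    by (simp add: smult pauli_mat_zero right_mult_one_mat[of _ "2 ^ L" "2 ^ L"])
  finally show "trivial_on_code (dagger C * C) (P q)" by (auto simp: trivial_on_code_def)
next
  assume "trivial_on_code (dagger C * C) (P q)"
  then obtain c where c: "P q * (dagger C * C) = c \<cdot>\<^sub>m (dagger C * C)" by (auto simp: trivial_on_code_def)
  show "fixing (\<lambda>_. 0) q"
  proof (rule ccontr)
    assume "\<not> fixing (\<lambda>_. 0) q"
    then have "mtrace (dagger C * (P (\<lambda>_. 0) * (C * P q))) = 0"
      using dichotomy q pauli_string_zero unfolding stabilizer_dichotomy_def fixing_def by blast
    then have "mtrace ((dagger C * C) * P q) = 0"
      using C by (simp add: pauli_mat_zero assoc)
    moreover have "mtrace ((dagger C * C) * P q) = mtrace (P q * (dagger C * C))"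
      using C by (intro mtrace_comm[of _ "2 ^ L" "2 ^ L"]) auto
    ultimately have "c * complex_of_real nrm = 0"
      unfolding c using C by (simp add: mtrace_smult[of _ "2 ^ L"] mtrace_gram)
    then have "c = 0" using nrm_pos by simp
    have "dagger C * C = P q * (P q * (dagger C * C))"
      using C q by (simp add: assoc[symmetric] pauli_square left_mult_one_mat[of _ "2 ^ L" "2 ^ L"])
    also have "\<dots> = P q * (c \<cdot>\<^sub>m (dagger C * C))" by (simp only: c)
    also have "\<dots> = 0 \<cdot>\<^sub>m (P q * (dagger C * C))"
      using C \<open>c = 0\<close> by (simp add: smult)
    finally have "mtrace (dagger C * C) = mtrace (0 \<cdot>\<^sub>m (P q * (dagger C * C)))" by simp
    also have "\<dots> = 0" using C by (subst mtrace_smult[of _ "2 ^ L"]) auto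
    finally show False using nrm_pos by (simp add: mtrace_gram)
  qed
qed

lemma finite_transferred: "finite (transferred A B)"
  by (rule finite_subset[OF _ finite_pauli_strings[of L]]) (auto simp: transferred_def)

lemma is_subgroup_transferred: "pauli_group.is_subgroup (transferred A B)"
  unfolding pauli_group.is_subgroup_def
proof (intro conjI ballI)
  show "(\<lambda>_. 0) \<in> transferred A B"
    unfolding transferred_def using fixing_zero pauli_string_zero supported_on_zero by blast
  fix q q' assume "q \<in> transferred A B" "q' \<in> transferred A B"
  then show "pxor q q' \<in> transferred A B"
    unfolding transferred_def using fixing_pxor pauli_string_pxor supported_on_pxor
    by (smt (verit, best) mem_Collect_eq)
qed

lemma supported_on_empty: "supported_on p {} \<longleftrightarrow> p = (\<lambda>_. 0)"
  by (auto simp: supported_on_def)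

text \<open>The trivial operators are those transferred to the identity, whose support is empty and
  hence lies in every \<open>B\<close>.\<close>

lemma trivial_transferred:
  "{q \<in> transferred A B. trivial_on_code (dagger C * C) (P q)} = transferred A {}"
  using trivial_on_code_iff
  by (auto simp: transferred_def supported_on_empty intro!: exI[of _ "\<lambda>_. 0"])

text \<open>\<open>num_transferable\<close> is the rank of the quotient of
  \<open>transferred A B\<close> by its subgroup of trivial operators.\<close>

lemma card_transferred:
  "2 ^ num_transferable L C A B * card (transferred A {}) = card (transferred A B)"
proof -
  let ?V = "transferred A B" and ?Pr = "dagger C * C"
  have Pr: "?Pr \<in> carrier_mat (2 ^ L) (2 ^ L)" using C by simp
  have indep: "independent_logicals L ?Pr S \<longleftrightarrow> pauli_group.independent_mod (transferred A {}) S"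
    if S: "S \<subseteq> ?V" for S
  proof -
    have "independent_logicals L ?Pr S \<longleftrightarrow>
        pauli_group.independent_mod {p. trivial_on_code ?Pr (P p)} S"
      using S by (intro independent_logicals_iff Pr) (auto simp: transferred_def)
    \<comment> \<open>Products of elements of \<open>S\<close> stay in the group \<open>?V\<close>,
      so only trivial operators inside \<open>?V\<close> matter.\<close>
    also have "\<dots> \<longleftrightarrow> pauli_group.independent_mod {q \<in> ?V. trivial_on_code ?Pr (P q)} S"
      using pauli_group.F_closed[OF _ is_subgroup_transferred, of _ A B] S
      unfolding pauli_group.independent_mod_def by (auto dest: subset_trans)
    finally show ?thesis unfolding trivial_transferred .
  qed
  have "{card S |S. S \<subseteq> {p. transferable L C A B p} \<and> independent_logicals L ?Pr S}
      = {card S |S. S \<subseteq> ?V \<and> pauli_group.independent_mod (transferred A {}) S}"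
    using indep by (auto simp: transferable_iff)
  moreover have "transferred A {} \<subseteq> ?V" using trivial_transferred by blast
  ultimately show ?thesis
    unfolding num_transferable_def
    using pauli_group.Max_independent[OF finite_transferred is_subgroup_transferred is_subgroup_transferred] by simp
qed

text \<open>The outputs compatible with a transferred \<open>q\<close> form a coset of those
  compatible with the identity input; translation by any one of them is a bijection and its own
  inverse.\<close>

lemma card_stab: "card (stab A B) = card (transferred A B) * card (stab {} B)"
proof -
  define K where "K q = {p. pauli_string L p \<and> supported_on p B \<and> fixing p q}" for q
  have card_K: "card (K q) = card (K (\<lambda>_. 0))" if q: "q \<in> transferred A B" for q
  proof -
    obtain p where p: "p \<in> K q" using q by (auto simp: transferred_def K_def)
    have q': "pauli_string L q" using q by (simp add: transferred_def)
    have "bij_betw (pxor p) (K (\<lambda>_. 0)) (K q)"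
    proof (rule bij_betwI[where g = "pxor p"])
      show "pxor p \<in> K (\<lambda>_. 0) \<rightarrow> K q"
        using p q' fixing_pxor[of p _ q "\<lambda>_. 0"] by (auto simp: K_def pauli_string_pxor supported_on_pxor)
      show "pxor p \<in> K q \<rightarrow> K (\<lambda>_. 0)"
        using p q' fixing_pxor[of p _ q q] by (auto simp: K_def pauli_string_pxor supported_on_pxor)
    qed auto
    then show ?thesis by (simp add: bij_betw_same_card)
  qed
  have fin: "finite (K q)" for q
    by (rule finite_subset[OF _ finite_pauli_strings[of L]]) (auto simp: K_def)
  have "stab A B = (SIGMA q:transferred A B. K q)"
    by (auto simp: stab_def transferred_def K_def)
  then have "card (stab A B) = (\<Sum>q\<in>transferred A B. card (K q))"
    using finite_transferred fin by simp
  also have "\<dots> = card (transferred A B) * card (K (\<lambda>_. 0))" using card_K by simp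
  also have "stab {} B = {\<lambda>_. 0} \<times> K (\<lambda>_. 0)"
    by (auto simp: stab_def K_def supported_on_empty)
  then have "card (K (\<lambda>_. 0)) = card (stab {} B)" by (simp add: card_cartesian_product)
  finally show ?thesis .
qed

lemma stab_empty: "stab A {} = transferred A {} \<times> {\<lambda>_. 0}"
  by (auto simp: stab_def transferred_def supported_on_empty)

lemma card_stab_pos: "card (stab A B) > 0"
proof -
  have "((\<lambda>_. 0), (\<lambda>_. 0)) \<in> stab A B" by (simp add: stab_def fixing_zero)
  moreover have "stab A B \<subseteq> {q. pauli_string L q} \<times> {p. pauli_string L p}" by (auto simp: stab_def)
  then have "finite (stab A B)" by (rule finite_subset) simp
  ultimately show ?thesis using card_gt_0_iff by blast
qed

lemma mutual_info_choi_state: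
  assumes "A \<subseteq> {0..<L}" "B \<subseteq> {0..<L}"
  shows "mutual_info (2 * L) (choi_state L C) ((\<lambda>a. L + a) ` A) B = real (num_transferable L C A B)"
proof -
  have "card (stab A B) = 2 ^ num_transferable L C A B * card (stab A {}) * card (stab {} B)"
    by (simp add: card_stab[of A B] card_transferred[symmetric, of A B] stab_empty card_cartesian_product)
  then have "real (card (stab A B)) = 2 ^ num_transferable L C A B * real (card (stab A {})) * real (card (stab {} B))"
    by simp
  then have "log 2 (real (card (stab A B)))
      = real (num_transferable L C A B) + log 2 (real (card (stab A {}))) + log 2 (real (card (stab {} B)))"
    using card_stab_pos[of A "{}"] card_stab_pos[of "{}" B] by (simp add: log_mult log_nat_power)
  then show ?thesis using mutual_info_eq[OF assms] by simp
qed

end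

theorem theorem1:
  fixes L :: nat and gs :: "gate list" and A B :: "nat set"
  assumes "\<forall>g\<in>set gs. valid_gate L g"
    and "circuit_mat L gs \<noteq> 0\<^sub>m (2 ^ L) (2 ^ L)"
    and "A \<subseteq> {0..<L}" and "B \<subseteq> {0..<L}"
  shows "mutual_info (2 * L) (choi_state L (circuit_mat L gs)) ((\<lambda>a. L + a) ` A) B
         = real (num_transferable L (circuit_mat L gs) A B)"
proof -
  interpret stabilizer_map L "circuit_mat L gs"
    using circuit_mat_invariants[OF assms(1)] assms(2) by unfold_locales auto
  show ?thesis by (rule mutual_info_choi_state[OF assms(3,4)])
qed

end
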